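(* For any fixed $k$ sufficiently large, any algorithm achieving an approximation ratio better than $1.268$ for the Symmetric Submodular Multiway Partition problem with $k$ terminals in the value oracle model requires exponentially many value queries.
   Context: Symmetric Submodular Multiway Partition: given a finite ground set $V$, a nonnegative submodular function $f:2^V\to\mathbb{R}_+$ that is symmetric ($f(S)=f(V\setminus S)$ for all $S$), accessible only through a value oracle, and $k$ distinct terminals $t_1,\ldots,t_k\in V$, find a partition $A_1,\ldots,A_k$ of $V$ with $t_i\in A_i$ minimizing $\sum_{i=1}^k f(A_i)$. "Exponentially many" means exponential in the size of the ground set. *)

theory Defs
  imports "HOL-Probability.Probability"
begin

text \<open>Instances: ground set V = {..<n}; terminals t 0, ..., t (k-1) (distinct, in V);
  f : nat set => real given by a value oracle. A solution is an assignment
  sigma : nat => nat; part i is A_i = {v in V. sigma v = i}.\<close>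

definition symmetric_on :: "nat set \<Rightarrow> (nat set \<Rightarrow> real) \<Rightarrow> bool" where
  "symmetric_on V f \<longleftrightarrow> (\<forall>S. S \<subseteq> V \<longrightarrow> f S = f (V - S))"

definition submodular_on :: "nat set \<Rightarrow> (nat set \<Rightarrow> real) \<Rightarrow> bool" where
  "submodular_on V f \<longleftrightarrow>
     (\<forall>S T. S \<subseteq> V \<longrightarrow> T \<subseteq> V \<longrightarrow> f (S \<union> T) + f (S \<inter> T) \<le> f S + f T)"

definition nonneg_on :: "nat set \<Rightarrow> (nat set \<Rightarrow> real) \<Rightarrow> bool" where
  "nonneg_on V f \<longleftrightarrow> (\<forall>S. S \<subseteq> V \<longrightarrow> 0 \<le> f S)"

definition valid_terminals :: "nat \<Rightarrow> nat \<Rightarrow> (nat \<Rightarrow> nat) \<Rightarrow> bool" where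
  "valid_terminals k n t \<longleftrightarrow> inj_on t {..<k} \<and> t ` {..<k} \<subseteq> {..<n}"

definition valid_instance :: "nat \<Rightarrow> nat \<Rightarrow> (nat \<Rightarrow> nat) \<Rightarrow> (nat set \<Rightarrow> real) \<Rightarrow> bool" where
  "valid_instance k n t f \<longleftrightarrow> valid_terminals k n t \<and>
     nonneg_on {..<n} f \<and> submodular_on {..<n} f \<and> symmetric_on {..<n} f"

definition valid_partition :: "nat \<Rightarrow> nat \<Rightarrow> (nat \<Rightarrow> nat) \<Rightarrow> (nat \<Rightarrow> nat) \<Rightarrow> bool" where
  "valid_partition k n t \<sigma> \<longleftrightarrow> (\<forall>v<n. \<sigma> v < k) \<and> (\<forall>i<k. \<sigma> (t i) = i)"

definition part_cost :: "nat \<Rightarrow> nat \<Rightarrow> (nat set \<Rightarrow> real) \<Rightarrow> (nat \<Rightarrow> nat) \<Rightarrow> real" where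
  "part_cost k n f \<sigma> = (\<Sum>i<k. f {v\<in>{..<n}. \<sigma> v = i})"

definition opt_cost :: "nat \<Rightarrow> nat \<Rightarrow> (nat \<Rightarrow> nat) \<Rightarrow> (nat set \<Rightarrow> real) \<Rightarrow> real" where
  "opt_cost k n t f = Min {part_cost k n f \<sigma> | \<sigma>. valid_partition k n t \<sigma>}"

text \<open>Deterministic adaptive value-oracle algorithms as decision trees: either output an
  assignment, or query the oracle on a set and continue depending on the answer.\<close>
datatype dtree = Output "nat \<Rightarrow> nat" | Query "nat set" "real \<Rightarrow> dtree"

primrec run :: "(nat set \<Rightarrow> real) \<Rightarrow> dtree \<Rightarrow> (nat \<Rightarrow> nat)" where
  "run f (Output \<sigma>) = \<sigma>"
| "run f (Query S g) = (run f \<circ> g) (f S)"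

primrec num_queries :: "(nat set \<Rightarrow> real) \<Rightarrow> dtree \<Rightarrow> nat" where
  "num_queries f (Output \<sigma>) = 0"
| "num_queries f (Query S g) = Suc ((num_queries f \<circ> g) (f S))"

text \<open>A randomized algorithm for ground-set size n: for each terminal vector, a probability
  distribution over deterministic decision trees (deterministic ones are point masses).
  It achieves approximation ratio r if on every instance it always outputs a feasible
  partition and its expected cost is at most r times the optimum.\<close>
definition achieves_ratio ::
  "nat \<Rightarrow> nat \<Rightarrow> real \<Rightarrow> ((nat \<Rightarrow> nat) \<Rightarrow> dtree pmf) \<Rightarrow> bool" where
  "achieves_ratio k n r Alg \<longleftrightarrow>
     (\<forall>t f. valid_instance k n t f \<longrightarrow>
        (\<forall>T\<in>set_pmf (Alg t). valid_partition k n t (run f T)) \<and>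
        measure_pmf.expectation (Alg t) (\<lambda>T. part_cost k n f (run f T)) \<le> r * opt_cost k n t f)"

end

theory Submission
  imports Defs "HOL-Combinatorics.Permutations" "HOL-Library.Multiset" "HOL-Real_Asymp.Real_Asymp"
begin

text \<open>A partition problem with a symmetry gap is hidden inside an oracle. For a weight measure w of
  total mass 1 the function min (w S) (1 - w S) is symmetric submodular, and a partition pays for it
  min 1 (2 (1 - m)) where m is the largest weight of a part. The instance has k terminals and one
  point for every multiset {a, b, c} of terminals, standing for the point (e_a + e_b + e_c) / 3 of
  the simplex. The hyperedge (i, j) carries the points {i, j, r} for all r (and the terminal i if
  i = j). A point is blown up into triples of elements, and the three elements of each triple are
  secretly named a, b, c. Each hyperedge has three copies; copy one sees only the elements named i,
  copy two those named j, and copy three those named r. Giving every element the label it is named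
  after leaves the first two copies uncut, so this partition costs at most 1 per hyperedge. An
  algorithm that makes few queries cannot distinguish the hidden names from the average over all
  namings, for which each hyperedge costs three times its average cost under a fractional labelling
  of the points. With the weights below this averaged cost is at least 1.268.

  For the lower bound, colour a pair {i, j} by the label that holds more than half of its hyperedge,
  if there is one. The labels of the points {i, j, r} can agree with only some of the colours of the
  three pairs of each triple. This reduces the bound to an inequality between the in- and outdegrees
  of the oriented graph of pairs coloured by one of their own ends, and that inequality follows from
  Landau's bound on score sequences.\<close>

section \<open>Decision trees and submodular functions\<close>

primrec queries :: "(nat set \<Rightarrow> real) \<Rightarrow> dtree \<Rightarrow> nat set list" where
  "queries f (Output \<sigma>) = []"
| "queries f (Query S g) = S # (queries f \<circ> g) (f S)"

lemma length_queries: "length (queries f T) = num_queries f T"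
  by (induction T) auto

lemma run_cong:
  "(\<And>S. S \<in> set (queries f T) \<Longrightarrow> f' S = f S) \<Longrightarrow> run f' T = run f T"
  by (induction T) auto

lemma submodular_on_add:
  "submodular_on V f \<Longrightarrow> submodular_on V g \<Longrightarrow> submodular_on V (\<lambda>S. f S + g S)"
  unfolding submodular_on_def by (smt (verit))

lemma submodular_on_const: "submodular_on V (\<lambda>S. c)"
  unfolding submodular_on_def by auto

lemma submodular_on_cmult:
  "c \<ge> 0 \<Longrightarrow> submodular_on V f \<Longrightarrow> submodular_on V (\<lambda>S. c * f S)"
  unfolding submodular_on_def by (metis distrib_left mult_left_mono)

lemma submodular_on_sum:
  "(\<And>x. x \<in> X \<Longrightarrow> submodular_on V (f x)) \<Longrightarrow> submodular_on V (\<lambda>S. \<Sum>x\<in>X. f x S)"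
  by (induction X rule: infinite_finite_induct)
     (auto intro!: submodular_on_add simp: submodular_on_const)

lemma submodular_on_compl:
  assumes "submodular_on V f"
  shows "submodular_on V (\<lambda>S. f (V - S))"
  unfolding submodular_on_def
proof (intro allI impI)
  fix S T assume "S \<subseteq> V" "T \<subseteq> V"
  have "V - (S \<union> T) = (V - S) \<inter> (V - T)" "V - (S \<inter> T) = (V - S) \<union> (V - T)" by auto
  then show "f (V - (S \<union> T)) + f (V - S \<inter> T) \<le> f (V - S) + f (V - T)"
    using assms unfolding submodular_on_def
    by (metis Diff_subset add.commute)
qed

lemma submodular_on_min_const:
  assumes sub: "submodular_on V f" and mono: "\<And>S T. S \<subseteq> T \<Longrightarrow> f S \<le> f T"
  shows "submodular_on V (\<lambda>S. min (f S) c)"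
  unfolding submodular_on_def
proof (intro allI impI)
  fix S T assume "S \<subseteq> V" "T \<subseteq> V"
  then have "f (S \<union> T) + f (S \<inter> T) \<le> f S + f T"
    using sub unfolding submodular_on_def by auto
  moreover have "f (S \<inter> T) \<le> f S" "f (S \<inter> T) \<le> f T" "f S \<le> f (S \<union> T)" "f T \<le> f (S \<union> T)"
    using mono by auto
  ultimately show "min (f (S \<union> T)) c + min (f (S \<inter> T)) c \<le> min (f S) c + min (f T) c"
    by linarith
qed

lemma Hoeffding_Pi_pmf:
  fixes p :: "'b \<Rightarrow> 'c pmf" and X :: "'b \<Rightarrow> 'c \<Rightarrow> real" and \<epsilon> :: real
  assumes fin: "finite I" and JI: "J \<subseteq> I" and J: "J \<noteq> {}"
    and bd: "\<And>i y. i \<in> J \<Longrightarrow> X i y \<in> {0..1}" and eps: "\<epsilon> \<ge> 0"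
  shows "measure_pmf.prob (Pi_pmf I d p)
      {f. \<bar>(\<Sum>i\<in>J. X i (f i)) - (\<Sum>i\<in>J. measure_pmf.expectation (p i) (X i))\<bar> \<ge> \<epsilon> * card J}
     \<le> 2 * exp (-2 * \<epsilon>\<^sup>2 * card J)"
proof -
  let ?M = "Pi_pmf I d p"
  have finJ: "finite J" using fin JI finite_subset by blast
  have cJ: "card J > 0" using finJ J by auto
  have ind: "prob_space.indep_vars (measure_pmf ?M) (\<lambda>_. count_space UNIV) (\<lambda>x f. f x) J"
    using indep_vars_Pi_pmf[OF fin] JI
    by (rule prob_space.indep_vars_subset[OF prob_space_measure_pmf])
  interpret H: indep_interval_bounded_random_variables "measure_pmf ?M" J
      "\<lambda>i f. X i (f i)" "\<lambda>_. 0" "\<lambda>_. 1"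
  proof
    show "finite J" by (rule finJ)
    show "prob_space.indep_vars (measure_pmf ?M) (\<lambda>_. borel) (\<lambda>i f. X i (f i)) J"
      by (rule prob_space.indep_vars_compose2[OF prob_space_measure_pmf ind]) auto
    show "AE x in measure_pmf ?M. X i (x i) \<in> {0..1}" if "i \<in> J" for i
      using bd[OF that] by auto
  qed
  interpret Hoeffding_ineq "measure_pmf ?M" J "\<lambda>i f. X i (f i)" "\<lambda>_. 0" "\<lambda>_. 1"
      "\<Sum>i\<in>J. measure_pmf.expectation ?M (\<lambda>f. X i (f i))"
    by unfold_locales
  have ex: "measure_pmf.expectation ?M (\<lambda>f. X i (f i)) = measure_pmf.expectation (p i) (X i)"
    if "i \<in> J" for i
  proof -
    have "measure_pmf.expectation (p i) (X i)
        = measure_pmf.expectation (map_pmf (\<lambda>f. f i) ?M) (X i)"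
      using that JI by (subst Pi_pmf_component[OF fin]) auto
    then show ?thesis by simp
  qed
  have "measure_pmf.prob ?M {f\<in>space (measure_pmf ?M). \<bar>(\<Sum>i\<in>J. X i (f i)) - (\<Sum>i\<in>J. measure_pmf.expectation ?M (\<lambda>f. X i (f i)))\<bar> \<ge> \<epsilon> * card J}
     \<le> 2 * exp (-2 * (\<epsilon> * card J)\<^sup>2 / (\<Sum>i\<in>J. (1 - 0 :: real)\<^sup>2))"
    by (rule Hoeffding_ineq_abs_ge) (use eps cJ in auto)
  also have "-2 * (\<epsilon> * card J)\<^sup>2 / (\<Sum>i\<in>J. (1 - 0 :: real)\<^sup>2) = -2 * \<epsilon>\<^sup>2 * card J"
    using cJ by (simp add: power2_eq_square)
  finally show ?thesis by (simp add: ex)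
qed

section \<open>Symmetry gaps imply query lower bounds\<close>

definition hat :: "real \<Rightarrow> real" where
  "hat x = min x (1 - x)"

lemma hat_le: "hat x \<le> x"
  by (simp add: hat_def)

lemma sum_lessThan_3: "(\<Sum>\<omega><3. h \<omega>) = h 0 + h 1 + (h 2 :: real)" for h :: "nat \<Rightarrow> real"
  by (simp add: numeral_3_eq_3 numeral_2_eq_2)

lemma sum_shift_mod3:
  fixes h :: "nat \<Rightarrow> real"
  shows "(\<Sum>\<omega><3. h ((\<omega> + s) mod 3)) = (\<Sum>a<3. h a)"
proof -
  define r where "r = s mod 3"
  have "(\<Sum>\<omega><3. h ((\<omega> + s) mod 3)) = (\<Sum>\<omega><3. h ((\<omega> + r) mod 3))"
    by (simp add: r_def mod_add_right_eq)
  moreover have "r = 0 \<or> r = 1 \<or> r = 2" unfolding r_def by linarith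
  ultimately show ?thesis by (auto simp: sum_lessThan_3 numeral_2_eq_2)
qed

lemma connectivity_function:
  assumes sub: "submodular_on V g" and e: "g {} = 0" and c: "g V = c"
  shows "submodular_on V (\<lambda>S. g S + g (V - S) - c)"
    and "symmetric_on V (\<lambda>S. g S + g (V - S) - c)"
    and "nonneg_on V (\<lambda>S. g S + g (V - S) - c)"
proof -
  have "submodular_on V (\<lambda>S. (g S + g (V - S)) + (-c))"
    by (rule submodular_on_add[OF submodular_on_add[OF sub submodular_on_compl[OF sub]]
          submodular_on_const])
  then show "submodular_on V (\<lambda>S. g S + g (V - S) - c)" by simp
  show "symmetric_on V (\<lambda>S. g S + g (V - S) - c)"
    unfolding symmetric_on_def by (simp add: Diff_Diff_Int Int_absorb1 add.commute)
  show "nonneg_on V (\<lambda>S. g S + g (V - S) - c)"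
    unfolding nonneg_on_def
  proof (intro allI impI)
    fix S assume S: "S \<subseteq> V"
    have "g (S \<union> (V - S)) + g (S \<inter> (V - S)) \<le> g S + g (V - S)"
      by (rule sub[unfolded submodular_on_def, rule_format]) (use S in auto)
    moreover have "S \<union> (V - S) = V" "S \<inter> (V - S) = {}" using S by auto
    ultimately show "0 \<le> g S + g (V - S) - c" using e c by (simp only:)
  qed
qed

locale gap_instance =
  fixes k :: nat and Pt :: "'v set" and lab :: "'v \<Rightarrow> nat \<Rightarrow> nat"
    and E :: "'e set" and mu :: "'e \<Rightarrow> real"
    and U :: "'e \<Rightarrow> nat \<Rightarrow> real" and W :: "'e \<Rightarrow> 'v \<Rightarrow> real" and rho :: "'e \<Rightarrow> 'v \<Rightarrow> nat \<Rightarrow> nat"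
  assumes k_pos: "k > 0"
    and finite_Pt: "finite Pt" and finite_E: "finite E"
    and mu_nonneg: "e \<in> E \<Longrightarrow> mu e \<ge> 0" and mu_sum: "(\<Sum>e\<in>E. mu e) = 1"
    and U_nonneg: "e \<in> E \<Longrightarrow> U e i \<ge> 0" and W_nonneg: "e \<in> E \<Longrightarrow> W e v \<ge> 0"
    and weight_sum: "e \<in> E \<Longrightarrow> (\<Sum>i<k. U e i) + (\<Sum>v\<in>Pt. W e v) = 1"
    and lab_less: "v \<in> Pt \<Longrightarrow> \<omega> < 3 \<Longrightarrow> lab v \<omega> < k"
    and rho_permutes: "e \<in> E \<Longrightarrow> v \<in> Pt \<Longrightarrow> rho e v permutes {..<3}"
    and unanimous: "e \<in> E \<Longrightarrow> \<omega> < 2 \<Longrightarrow>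
      \<exists>c<k. (\<forall>i<k. U e i > 0 \<longrightarrow> i = c) \<and> (\<forall>v\<in>Pt. W e v > 0 \<longrightarrow> lab v (rho e v \<omega>) = c)"

locale blowup = gap_instance k Pt lab E mu U W rho
  for k :: nat and Pt :: "'v set" and lab :: "'v \<Rightarrow> nat \<Rightarrow> nat"
    and E :: "'e set" and mu :: "'e \<Rightarrow> real"
    and U :: "'e \<Rightarrow> nat \<Rightarrow> real" and W :: "'e \<Rightarrow> 'v \<Rightarrow> real" and rho :: "'e \<Rightarrow> 'v \<Rightarrow> nat \<Rightarrow> nat" +
  fixes n L :: nat and idx :: "'v \<Rightarrow> nat" and \<delta> :: real
  assumes L_pos: "L > 0" and \<delta>_pos: "\<delta> > 0"
    and idx_inj: "inj_on idx Pt" and idx_less: "v \<in> Pt \<Longrightarrow> idx v < card Pt"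
    and size: "k + 3 * card Pt * L \<le> n"
begin

text \<open>The elements of a point come in cells of three. For a hidden shift s, the element
  cell v m ((\<omega> + s (v, m)) mod 3) belongs to copy \<omega> of v and is named lab v \<omega>.\<close>

definition cell :: "'v \<Rightarrow> nat \<Rightarrow> nat \<Rightarrow> nat" where
  "cell v m a = k + 3 * (idx v * L + m) + a"

definition cfrac :: "('v \<times> nat \<Rightarrow> nat) \<Rightarrow> nat set \<Rightarrow> 'v \<Rightarrow> nat \<Rightarrow> real" where
  "cfrac s S v \<omega> = (\<Sum>m<L. of_bool (cell v m ((\<omega> + s (v, m)) mod 3) \<in> S)) / L"

definition mfrac :: "nat set \<Rightarrow> 'v \<Rightarrow> real" where
  "mfrac S v = (\<Sum>m<L. \<Sum>a<3. of_bool (cell v m a \<in> S)) / (3 * L)"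

definition whid :: "('v \<times> nat \<Rightarrow> nat) \<Rightarrow> 'e \<Rightarrow> nat \<Rightarrow> nat set \<Rightarrow> real" where
  "whid s e \<omega> S = (\<Sum>i<k. U e i * of_bool (i \<in> S)) + (\<Sum>v\<in>Pt. W e v * cfrac s S v (rho e v \<omega>))"

definition wsym :: "'e \<Rightarrow> nat set \<Rightarrow> real" where
  "wsym e S = (\<Sum>i<k. U e i * of_bool (i \<in> S)) + (\<Sum>v\<in>Pt. W e v * mfrac S v)"

text \<open>The inner truncation lies slightly above 1/2 and the outer one exactly at 3/2, so that the value
  is a function of the average of the three weights as soon as each of them is within \<delta> of it.\<close>

definition ghid :: "('v \<times> nat \<Rightarrow> nat) \<Rightarrow> 'e \<Rightarrow> nat set \<Rightarrow> real" where
  "ghid s e S = min (\<Sum>\<omega><3. min (whid s e \<omega> S) (1/2 + 3 * \<delta>)) (3/2)"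

definition F :: "('v \<times> nat \<Rightarrow> nat) \<Rightarrow> nat set \<Rightarrow> real" where
  "F s S = (\<Sum>e\<in>E. mu e * (ghid s e S + ghid s e ({..<n} - S) - 3/2))"

definition G :: "nat set \<Rightarrow> real" where
  "G S = (\<Sum>e\<in>E. mu e * (3 * (min (wsym e S) (1/2) + min (wsym e ({..<n} - S)) (1/2) - 1/2)))"

definition balanced :: "('v \<times> nat \<Rightarrow> nat) \<Rightarrow> nat set \<Rightarrow> bool" where
  "balanced s S \<longleftrightarrow> (\<forall>v\<in>Pt. \<forall>\<omega><3. \<bar>cfrac s S v \<omega> - mfrac S v\<bar> \<le> \<delta>)"

lemma cell_ge: "k \<le> cell v m a"
  by (simp add: cell_def)

lemma cell_less:
  assumes "v \<in> Pt" "m < L" "a < 3"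
  shows "cell v m a < n"
proof -
  have "idx v + 1 \<le> card Pt" using idx_less[OF assms(1)] by simp
  then have "(idx v + 1) * L \<le> card Pt * L" by (rule mult_le_mono1)
  then have "idx v * L + m + 1 \<le> card Pt * L" using assms by simp
  then show ?thesis using size assms unfolding cell_def by simp
qed

lemma cell_eqD:
  assumes "cell v m a = cell v' m' a'" "v \<in> Pt" "v' \<in> Pt" "m < L" "m' < L" "a < 3" "a' < 3"
  shows "v = v'" "m = m'" "a = a'"
proof -
  have eq: "3 * (idx v * L + m) + a = 3 * (idx v' * L + m') + a'"
    using assms(1) by (simp add: cell_def)
  have "(3 * (idx v * L + m) + a) mod 3 = a" "(3 * (idx v' * L + m') + a') mod 3 = a'"
    using assms(6,7) by (simp_all only: mod_mult_self4 mod_less)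
  then show a: "a = a'" using eq by simp
  then have q: "idx v * L + m = idx v' * L + m'" using eq by simp
  have "(idx v * L + m) mod L = m" "(idx v' * L + m') mod L = m'" using assms by auto
  then show m: "m = m'" using q by simp
  then have "idx v = idx v'" using q L_pos by simp
  then show "v = v'" using idx_inj assms by (meson inj_onD)
qed

lemma cfrac_mono: "S \<subseteq> T \<Longrightarrow> cfrac s S v \<omega> \<le> cfrac s T v \<omega>"
  unfolding cfrac_def by (intro divide_right_mono sum_mono) auto

lemma cfrac_modular: "cfrac s (S \<union> T) v \<omega> + cfrac s (S \<inter> T) v \<omega> = cfrac s S v \<omega> + cfrac s T v \<omega>"
  unfolding cfrac_def add_divide_distrib[symmetric] sum.distrib[symmetric]
  by (intro arg_cong2[where f = "(/)"] sum.cong) auto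

lemma cfrac_empty: "cfrac s {} v \<omega> = 0"
  by (simp add: cfrac_def)

lemma cfrac_full: "v \<in> Pt \<Longrightarrow> cfrac s {..<n} v \<omega> = 1"
  using L_pos by (simp add: cfrac_def cell_less)

lemma sum_cfrac: "(\<Sum>\<omega><3. cfrac s S v \<omega>) = 3 * mfrac S v"
proof -
  have "(\<Sum>\<omega><3. cfrac s S v \<omega>) = (\<Sum>m<L. \<Sum>\<omega><3. of_bool (cell v m ((\<omega> + s (v, m)) mod 3) \<in> S)) / L"
    unfolding cfrac_def sum_divide_distrib[symmetric] by (subst sum.swap) simp
  also have "\<dots> = (\<Sum>m<L. \<Sum>a<3. of_bool (cell v m a \<in> S)) / L"
    by (subst sum_shift_mod3[where h = "\<lambda>a. of_bool (cell v _ a \<in> S)"]) simp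
  finally show ?thesis by (simp add: mfrac_def)
qed

lemma mfrac_nonneg: "mfrac S v \<ge> 0"
  unfolding mfrac_def by (intro divide_nonneg_nonneg sum_nonneg) auto

lemma sum_cfrac_rho:
  assumes "e \<in> E" "v \<in> Pt"
  shows "(\<Sum>\<omega><3. cfrac s S v (rho e v \<omega>)) = 3 * mfrac S v"
  using sum.permute[OF rho_permutes[OF assms], of "cfrac s S v"] by (simp only: sum_cfrac o_def)

lemma sum_whid:
  assumes "e \<in> E"
  shows "(\<Sum>\<omega><3. whid s e \<omega> S) = 3 * wsym e S"
proof -
  have "(\<Sum>\<omega><3. \<Sum>v\<in>Pt. W e v * cfrac s S v (rho e v \<omega>))
      = (\<Sum>v\<in>Pt. W e v * (\<Sum>\<omega><3. cfrac s S v (rho e v \<omega>)))"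
    unfolding sum_distrib_left by (rule sum.swap)
  also have "\<dots> = (\<Sum>v\<in>Pt. 3 * (W e v * mfrac S v))"
    by (intro sum.cong) (auto simp: sum_cfrac_rho assms)
  also have "\<dots> = 3 * (\<Sum>v\<in>Pt. W e v * mfrac S v)"
    by (rule sum_distrib_left[symmetric])
  finally show ?thesis
    unfolding whid_def wsym_def sum.distrib by simp
qed

lemma whid_mono: "e \<in> E \<Longrightarrow> S \<subseteq> T \<Longrightarrow> whid s e \<omega> S \<le> whid s e \<omega> T"
  unfolding whid_def
  by (intro add_mono sum_mono mult_left_mono cfrac_mono U_nonneg W_nonneg) auto

lemma whid_modular:
  "whid s e \<omega> (S \<union> T) + whid s e \<omega> (S \<inter> T) = whid s e \<omega> S + whid s e \<omega> T"
proof -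
  have "(\<Sum>i<k. U e i * of_bool (i \<in> S \<union> T)) + (\<Sum>i<k. U e i * of_bool (i \<in> S \<inter> T))
      = (\<Sum>i<k. U e i * of_bool (i \<in> S)) + (\<Sum>i<k. U e i * of_bool (i \<in> T))"
    unfolding sum.distrib[symmetric] by (intro sum.cong) auto
  moreover have "(\<Sum>v\<in>Pt. W e v * cfrac s (S \<union> T) v (rho e v \<omega>)) + (\<Sum>v\<in>Pt. W e v * cfrac s (S \<inter> T) v (rho e v \<omega>))
      = (\<Sum>v\<in>Pt. W e v * cfrac s S v (rho e v \<omega>)) + (\<Sum>v\<in>Pt. W e v * cfrac s T v (rho e v \<omega>))"
    unfolding sum.distrib[symmetric] distrib_left[symmetric] cfrac_modular ..
  ultimately show ?thesis unfolding whid_def by simp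
qed

lemma whid_empty: "whid s e \<omega> {} = 0"
  by (simp add: whid_def cfrac_empty)

lemma whid_full:
  assumes "e \<in> E"
  shows "whid s e \<omega> {..<n} = 1"
proof -
  have "k \<le> n" using size by simp
  then have "(\<Sum>i<k. U e i * of_bool (i \<in> {..<n})) = (\<Sum>i<k. U e i)"
    by (intro sum.cong) auto
  then show ?thesis
    using weight_sum[OF assms] by (simp add: whid_def cfrac_full)
qed

lemma wsym_eq: "e \<in> E \<Longrightarrow> wsym e S = (\<Sum>\<omega><3. whid (\<lambda>_. 0) e \<omega> S) / 3"
  by (simp add: sum_whid)

lemma wsym_mono: "e \<in> E \<Longrightarrow> S \<subseteq> T \<Longrightarrow> wsym e S \<le> wsym e T"
  by (simp add: wsym_eq sum_mono whid_mono divide_right_mono)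

lemma wsym_modular:
  assumes "e \<in> E"
  shows "wsym e (S \<union> T) + wsym e (S \<inter> T) = wsym e S + wsym e T"
  by (simp only: wsym_eq[OF assms] add_divide_distrib[symmetric] sum.distrib[symmetric] whid_modular)

lemma wsym_empty: "wsym e {} = 0"
  by (simp add: wsym_def mfrac_def)

lemma wsym_full: "e \<in> E \<Longrightarrow> wsym e {..<n} = 1"
  by (simp add: wsym_eq whid_full)

lemma cfrac_restrict: "v \<in> Pt \<Longrightarrow> cfrac s (S \<inter> {..<n}) v \<omega> = cfrac s S v \<omega>"
  unfolding cfrac_def by (simp add: cell_less)

lemma whid_restrict: "whid s e \<omega> (S \<inter> {..<n}) = whid s e \<omega> S"
proof -
  have "k \<le> n" using size by simp
  then have "(\<Sum>i<k. U e i * of_bool (i \<in> S \<inter> {..<n})) = (\<Sum>i<k. U e i * of_bool (i \<in> S))"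
    by (intro sum.cong) auto
  then show ?thesis by (simp add: whid_def cfrac_restrict)
qed

lemma whid_compl:
  assumes "e \<in> E"
  shows "whid s e \<omega> ({..<n} - S) = 1 - whid s e \<omega> S"
proof -
  have "whid s e \<omega> ((S \<inter> {..<n}) \<union> ({..<n} - S)) + whid s e \<omega> ((S \<inter> {..<n}) \<inter> ({..<n} - S))
     = whid s e \<omega> (S \<inter> {..<n}) + whid s e \<omega> ({..<n} - S)"
    by (rule whid_modular)
  moreover have "(S \<inter> {..<n}) \<union> ({..<n} - S) = {..<n}" "(S \<inter> {..<n}) \<inter> ({..<n} - S) = {}" by auto
  ultimately show ?thesis by (simp add: whid_full[OF assms] whid_empty whid_restrict)
qed

lemma wsym_compl: "e \<in> E \<Longrightarrow> wsym e ({..<n} - S) = 1 - wsym e S"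
  by (simp add: wsym_eq whid_compl sum_subtractf diff_divide_distrib)

lemma G_eq: "G S = (\<Sum>e\<in>E. mu e * (3 * hat (wsym e S)))"
  unfolding G_def
proof (intro sum.cong refl)
  fix e assume "e \<in> E"
  then show "mu e * (3 * (min (wsym e S) (1/2) + min (wsym e ({..<n} - S)) (1/2) - 1/2))
      = mu e * (3 * hat (wsym e S))"
    by (simp add: wsym_compl hat_def min_def)
qed

lemma balanced_whid:
  assumes bal: "balanced s S" and e: "e \<in> E" and \<omega>: "\<omega> < 3"
  shows "\<bar>whid s e \<omega> S - wsym e S\<bar> \<le> \<delta>"
proof -
  have W1: "(\<Sum>v\<in>Pt. W e v) \<le> 1"
    using weight_sum[OF e] sum_nonneg[of "{..<k}" "U e"] U_nonneg[OF e] by fastforce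
  have "\<bar>whid s e \<omega> S - wsym e S\<bar> = \<bar>\<Sum>v\<in>Pt. W e v * (cfrac s S v (rho e v \<omega>) - mfrac S v)\<bar>"
    by (simp add: whid_def wsym_def right_diff_distrib sum_subtractf)
  also have "\<dots> \<le> (\<Sum>v\<in>Pt. \<bar>W e v * (cfrac s S v (rho e v \<omega>) - mfrac S v)\<bar>)"
    by (rule sum_abs)
  also have "\<dots> \<le> (\<Sum>v\<in>Pt. W e v * \<delta>)"
  proof (rule sum_mono)
    fix v assume v: "v \<in> Pt"
    have "rho e v \<omega> < 3" using rho_permutes[OF e v] \<omega> by (metis lessThan_iff permutes_in_image)
    then have "\<bar>cfrac s S v (rho e v \<omega>) - mfrac S v\<bar> \<le> \<delta>"
      using bal v unfolding balanced_def by auto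
    then show "\<bar>W e v * (cfrac s S v (rho e v \<omega>) - mfrac S v)\<bar> \<le> W e v * \<delta>"
      using W_nonneg[OF e] by (simp add: abs_mult mult_left_mono)
  qed
  also have "\<dots> = (\<Sum>v\<in>Pt. W e v) * \<delta>" by (simp add: sum_distrib_right)
  also have "\<dots> \<le> \<delta>" using W1 \<delta>_pos by simp
  finally show ?thesis .
qed

lemma min_joint_truncation:
  fixes x0 x1 x2 m d :: real
  assumes "x0 + x1 + x2 = 3 * m" "\<bar>x0 - m\<bar> \<le> d" "\<bar>x1 - m\<bar> \<le> d" "\<bar>x2 - m\<bar> \<le> d"
  shows "min (min x0 (1/2 + 3*d) + min x1 (1/2 + 3*d) + min x2 (1/2 + 3*d)) (3/2) = 3 * min m (1/2)"
proof (cases "m \<le> 1/2 + 2 * d")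
  case True
  have "x0 \<le> 1/2 + 3*d" "x1 \<le> 1/2 + 3*d" "x2 \<le> 1/2 + 3*d"
    using True assms(2-4) by (simp_all add: abs_le_iff)
  then have "min x0 (1/2 + 3*d) = x0" "min x1 (1/2 + 3*d) = x1" "min x2 (1/2 + 3*d) = x2"
    by (simp_all only: min_absorb1)
  then show ?thesis using assms(1) by (simp add: min_def)
next
  case False
  have d: "d \<ge> 0" using assms(2) by simp
  have "x0 \<ge> 1/2 + d" "x1 \<ge> 1/2 + d" "x2 \<ge> 1/2 + d"
    using False assms(2-4) by (simp_all add: abs_le_iff)
  then have ge: "min x0 (1/2 + 3*d) \<ge> 1/2" "min x1 (1/2 + 3*d) \<ge> 1/2" "min x2 (1/2 + 3*d) \<ge> 1/2"
    using d by simp_all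
  have "3/2 \<le> min x0 (1/2 + 3*d) + min x1 (1/2 + 3*d) + min x2 (1/2 + 3*d)"
    using add_mono[OF add_mono[OF ge(1,2)] ge(3)] by simp
  moreover have "min m (1/2) = 1/2" using False d by simp
  ultimately show ?thesis by (simp only: min_absorb2)
qed

lemma ghid_balanced:
  assumes e: "e \<in> E" and "\<And>\<omega>. \<omega> < 3 \<Longrightarrow> \<bar>whid s e \<omega> S - wsym e S\<bar> \<le> \<delta>"
  shows "ghid s e S = 3 * min (wsym e S) (1/2)"
  unfolding ghid_def sum_lessThan_3
  by (rule min_joint_truncation)
     (use assms(2)[of 0] assms(2)[of 1] assms(2)[of 2] sum_whid[OF e, of s S] in \<open>auto simp: sum_lessThan_3\<close>)

lemma F_balanced:
  assumes "balanced s S"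
  shows "F s S = G S"
  unfolding F_def G_def
proof (intro sum.cong refl)
  fix e assume e: "e \<in> E"
  have "ghid s e S = 3 * min (wsym e S) (1/2)"
    using balanced_whid[OF assms e] by (rule ghid_balanced[OF e])
  moreover have "ghid s e ({..<n} - S) = 3 * min (wsym e ({..<n} - S)) (1/2)"
  proof (rule ghid_balanced[OF e])
    fix \<omega> :: nat assume "\<omega> < 3"
    then show "\<bar>whid s e \<omega> ({..<n} - S) - wsym e ({..<n} - S)\<bar> \<le> \<delta>"
      using balanced_whid[OF assms e, of \<omega>] by (simp add: whid_compl[OF e] wsym_compl[OF e])
  qed
  ultimately show "mu e * (ghid s e S + ghid s e ({..<n} - S) - 3/2)
     = mu e * (3 * (min (wsym e S) (1/2) + min (wsym e ({..<n} - S)) (1/2) - 1/2))"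
    by simp
qed

lemma submodular_ghid:
  assumes "e \<in> E"
  shows "submodular_on V (ghid s e)"
  unfolding ghid_def
proof (rule submodular_on_min_const, rule submodular_on_sum, rule submodular_on_min_const)
  show "submodular_on V (whid s e \<omega>)" for \<omega>
    unfolding submodular_on_def by (simp add: whid_modular)
qed (auto intro!: sum_mono min.mono whid_mono[OF assms])

lemma ghid_empty: "ghid s e {} = 0"
  using \<delta>_pos by (simp add: ghid_def whid_empty)

lemma ghid_full:
  assumes "e \<in> E"
  shows "ghid s e {..<n} = 3/2"
proof -
  have "min 1 (1/2 + 3 * \<delta>) \<ge> 1/2" using \<delta>_pos by simp
  then have "3 * (1/2) \<le> 3 * min 1 (1/2 + 3 * \<delta>)" by (rule mult_left_mono) simp
  then have "3/2 \<le> 3 * min 1 (1/2 + 3 * \<delta>)" by simp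
  then have "min (3 * min 1 (1/2 + 3 * \<delta>)) (3/2) = 3/2" by (rule min_absorb2)
  then show ?thesis by (simp add: ghid_def whid_full[OF assms])
qed

lemma instance_sum:
  assumes "\<And>e. e \<in> E \<Longrightarrow> submodular_on {..<n} (h e)" "\<And>e. e \<in> E \<Longrightarrow> symmetric_on {..<n} (h e)"
    "\<And>e. e \<in> E \<Longrightarrow> nonneg_on {..<n} (h e)"
  shows "valid_instance k n (\<lambda>i. i) (\<lambda>S. \<Sum>e\<in>E. mu e * h e S)"
  unfolding valid_instance_def
proof (intro conjI)
  show "valid_terminals k n (\<lambda>i. i)"
    using size by (auto simp: valid_terminals_def)
  show "nonneg_on {..<n} (\<lambda>S. \<Sum>e\<in>E. mu e * h e S)"
    using assms(3) unfolding nonneg_on_def by (auto intro!: sum_nonneg mult_nonneg_nonneg mu_nonneg)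
  show "submodular_on {..<n} (\<lambda>S. \<Sum>e\<in>E. mu e * h e S)"
    by (rule submodular_on_sum, rule submodular_on_cmult) (simp_all add: mu_nonneg assms)
  show "symmetric_on {..<n} (\<lambda>S. \<Sum>e\<in>E. mu e * h e S)"
    unfolding symmetric_on_def
  proof (intro allI impI sum.cong refl)
    fix S e assume "S \<subseteq> {..<n}" "e \<in> E"
    then have "h e S = h e ({..<n} - S)" using assms(2) unfolding symmetric_on_def by blast
    then show "mu e * h e S = mu e * h e ({..<n} - S)" by (rule arg_cong)
  qed
qed

lemma valid_F: "valid_instance k n (\<lambda>i. i) (F s)"
  unfolding F_def
  by (rule instance_sum; rule connectivity_function[OF submodular_ghid ghid_empty ghid_full])

lemma valid_G: "valid_instance k n (\<lambda>i. i) G"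
proof -
  let ?g = "\<lambda>e S. 3 * min (wsym e S) (1/2)"
  have sub: "submodular_on {..<n} (?g e)" if "e \<in> E" for e
  proof (rule submodular_on_cmult)
    show "submodular_on {..<n} (\<lambda>S. min (wsym e S) (1/2))"
      by (rule submodular_on_min_const)
         (use wsym_modular[OF that] wsym_mono[OF that] in \<open>simp_all add: submodular_on_def\<close>)
  qed simp
  have "valid_instance k n (\<lambda>i. i)
     (\<lambda>S. \<Sum>e\<in>E. mu e * (?g e S + ?g e ({..<n} - S) - 3/2))"
    by (rule instance_sum; rule connectivity_function[OF sub]) (simp_all add: wsym_empty wsym_full)
  then show ?thesis by (simp add: G_def[abs_def] algebra_simps)
qed

lemma F_le: "F s S \<le> 3/2"
proof -
  have "F s S \<le> (\<Sum>e\<in>E. mu e * (3/2))"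
    unfolding F_def by (intro sum_mono mult_left_mono mu_nonneg) (auto simp: ghid_def)
  also have "\<dots> = 3/2" by (simp only: sum_distrib_right[symmetric] mu_sum mult_1)
  finally show ?thesis .
qed

end

lemma part_cost_cong:
  assumes "\<And>v. v < n \<Longrightarrow> \<sigma> v = \<sigma>' v"
  shows "part_cost k n f \<sigma> = part_cost k n f \<sigma>'"
proof -
  have "{v \<in> {..<n}. \<sigma> v = i} = {v \<in> {..<n}. \<sigma>' v = i}" for i using assms by auto
  then show ?thesis unfolding part_cost_def by simp
qed

lemma finite_part_costs: "finite {part_cost k n f \<sigma> | \<sigma>. valid_partition k n t \<sigma>}"
proof (rule finite_subset)
  show "{part_cost k n f \<sigma> | \<sigma>. valid_partition k n t \<sigma>}
     \<subseteq> part_cost k n f ` ({..<n} \<rightarrow>\<^sub>E {..<k})"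
  proof
    fix x assume "x \<in> {part_cost k n f \<sigma> | \<sigma>. valid_partition k n t \<sigma>}"
    then obtain \<sigma> where x: "x = part_cost k n f \<sigma>" and v: "valid_partition k n t \<sigma>" by auto
    have "x = part_cost k n f (restrict \<sigma> {..<n})"
      unfolding x by (rule part_cost_cong) simp
    moreover have "restrict \<sigma> {..<n} \<in> {..<n} \<rightarrow>\<^sub>E {..<k}"
      using v by (auto simp: valid_partition_def)
    ultimately show "x \<in> part_cost k n f ` ({..<n} \<rightarrow>\<^sub>E {..<k})" by blast
  qed
  show "finite (part_cost k n f ` ({..<n} \<rightarrow>\<^sub>E {..<k}))"
    by (intro finite_imageI finite_PiE) auto
qed

lemma opt_cost_le: "valid_partition k n t \<sigma> \<Longrightarrow> opt_cost k n t f \<le> part_cost k n f \<sigma>"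
  unfolding opt_cost_def by (rule Min_le[OF finite_part_costs]) auto

lemma part_cost_nonneg:
  assumes "nonneg_on {..<n} f"
  shows "part_cost k n f \<sigma> \<ge> 0"
  unfolding part_cost_def
proof (rule sum_nonneg)
  fix i
  have "{v \<in> {..<n}. \<sigma> v = i} \<subseteq> {..<n}" by auto
  then show "0 \<le> f {v \<in> {..<n}. \<sigma> v = i}" using assms unfolding nonneg_on_def by blast
qed

lemma opt_cost_nonneg:
  assumes "nonneg_on {..<n} f" "valid_partition k n t \<sigma>"
  shows "opt_cost k n t f \<ge> 0"
proof -
  have "opt_cost k n t f \<in> {part_cost k n f \<sigma> | \<sigma>. valid_partition k n t \<sigma>}"
    unfolding opt_cost_def by (rule Min_in[OF finite_part_costs]) (use assms(2) in blast)
  then show ?thesis using part_cost_nonneg[OF assms(1)] by auto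
qed

lemma truncation_le_hat:
  fixes x0 x1 x2 d :: real
  assumes "d > 0"
  shows "min (min x0 (1/2 + 3*d) + min x1 (1/2 + 3*d) + min x2 (1/2 + 3*d)) (3/2)
       + min (min (1-x0) (1/2 + 3*d) + min (1-x1) (1/2 + 3*d) + min (1-x2) (1/2 + 3*d)) (3/2) - 3/2
       \<le> hat x0 + hat x1 + hat x2 + 18 * d"
proof -
  have *: "min x (1/2 + 3*d) + min (1-x) (1/2 + 3*d) \<le> hat x + 1/2 + 6 * d" for x
    using assms by (simp add: hat_def min_def)
  have add: "A + B - 3/2 \<le> h0 + h1 + h2 + 18 * d"
    if "A \<le> a0 + a1 + a2" "B \<le> b0 + b1 + b2"
      "a0 + b0 \<le> h0 + 1/2 + 6 * d" "a1 + b1 \<le> h1 + 1/2 + 6 * d" "a2 + b2 \<le> h2 + 1/2 + 6 * d"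
    for A B a0 a1 a2 b0 b1 b2 h0 h1 h2 :: real
    using that by linarith
  show ?thesis by (rule add[OF min.cobounded1 min.cobounded1 * * *])
qed

context blowup
begin

definition hid :: "('v \<times> nat \<Rightarrow> nat) \<Rightarrow> nat \<Rightarrow> nat" where
  "hid s x = (if x < k then x
     else if \<exists>v\<in>Pt. \<exists>m<L. \<exists>\<omega><3. x = cell v m ((\<omega> + s (v, m)) mod 3)
     then THE l. \<exists>v\<in>Pt. \<exists>m<L. \<exists>\<omega><3. x = cell v m ((\<omega> + s (v, m)) mod 3) \<and> l = lab v \<omega>
     else 0)"

lemma hid_cell:
  assumes "v \<in> Pt" "m < L" "\<omega> < 3"
  shows "hid s (cell v m ((\<omega> + s (v, m)) mod 3)) = lab v \<omega>"
proof -
  let ?x = "cell v m ((\<omega> + s (v, m)) mod 3)"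
  have "(THE l. \<exists>v\<in>Pt. \<exists>m<L. \<exists>\<omega><3. ?x = cell v m ((\<omega> + s (v, m)) mod 3) \<and> l = lab v \<omega>) = lab v \<omega>"
  proof (rule the_equality)
    show "\<exists>v'\<in>Pt. \<exists>m'<L. \<exists>\<omega>'<3. ?x = cell v' m' ((\<omega>' + s (v', m')) mod 3) \<and> lab v \<omega> = lab v' \<omega>'"
      using assms by blast
  next
    fix l assume "\<exists>v'\<in>Pt. \<exists>m'<L. \<exists>\<omega>'<3. ?x = cell v' m' ((\<omega>' + s (v', m')) mod 3) \<and> l = lab v' \<omega>'"
    then obtain v' m' \<omega>' where *: "v' \<in> Pt" "m' < L" "\<omega>' < 3"
      "?x = cell v' m' ((\<omega>' + s (v', m')) mod 3)" "l = lab v' \<omega>'" by blast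
    have "v = v'" "m = m'" "(\<omega> + s (v, m)) mod 3 = (\<omega>' + s (v', m')) mod 3"
      using cell_eqD[OF *(4) assms(1) *(1) assms(2) *(2)] by simp_all
    then have "(\<omega> + s (v, m)) mod 3 = (\<omega>' + s (v, m)) mod 3" by simp
    then have "\<omega> = \<omega>'" using assms(3) *(3) by presburger
    then show "l = lab v \<omega>" using * \<open>v = v'\<close> by simp
  qed
  moreover have "\<not> ?x < k" using cell_ge by (simp add: not_less)
  moreover have "\<exists>v'\<in>Pt. \<exists>m'<L. \<exists>\<omega>'<3. ?x = cell v' m' ((\<omega>' + s (v', m')) mod 3)"
    using assms by blast
  ultimately show ?thesis unfolding hid_def by simp
qed

lemma hid_less: "hid s x < k"
proof (cases "x < k")
  case True
  then show ?thesis by (simp add: hid_def)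
next
  case False
  show ?thesis
  proof (cases "\<exists>v\<in>Pt. \<exists>m<L. \<exists>\<omega><3. x = cell v m ((\<omega> + s (v, m)) mod 3)")
    case True
    then show ?thesis using hid_cell lab_less by auto
  next
    case F: False
    then show ?thesis using False k_pos unfolding hid_def by (simp only: if_False)
  qed
qed

lemma valid_hid: "valid_partition k n (\<lambda>i. i) (hid s)"
  by (simp add: valid_partition_def hid_less) (simp add: hid_def)

definition hpart :: "('v \<times> nat \<Rightarrow> nat) \<Rightarrow> nat \<Rightarrow> nat set" where
  "hpart s l = {x \<in> {..<n}. hid s x = l}"

lemma cfrac_hpart:
  assumes "v \<in> Pt" "\<omega> < 3"
  shows "cfrac s (hpart s l) v \<omega> = of_bool (lab v \<omega> = l)"
proof -
  have "cell v m ((\<omega> + s (v, m)) mod 3) \<in> hpart s l \<longleftrightarrow> lab v \<omega> = l" if "m < L" for m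
    using cell_less[OF assms(1) that, of "(\<omega> + s (v, m)) mod 3"] hid_cell[OF assms(1) that assms(2)]
    by (simp add: hpart_def)
  then have "(\<Sum>m<L. of_bool (cell v m ((\<omega> + s (v, m)) mod 3) \<in> hpart s l))
      = (\<Sum>m<L. of_bool (lab v \<omega> = l) :: real)"
    by (intro sum.cong) auto
  then show ?thesis unfolding cfrac_def using L_pos by simp
qed

lemma whid_hpart:
  assumes e: "e \<in> E" and \<omega>: "\<omega> < 3"
  shows "whid s e \<omega> (hpart s l)
    = (\<Sum>i<k. U e i * of_bool (i = l)) + (\<Sum>v\<in>Pt. W e v * of_bool (lab v (rho e v \<omega>) = l))"
proof -
  have kn: "k \<le> n" using size by simp
  have "(\<Sum>i<k. U e i * of_bool (i \<in> hpart s l)) = (\<Sum>i<k. U e i * of_bool (i = l))"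
    using kn by (intro sum.cong) (auto simp: hid_def hpart_def)
  moreover have "cfrac s (hpart s l) v (rho e v \<omega>) = of_bool (lab v (rho e v \<omega>) = l)"
    if "v \<in> Pt" for v
  proof -
    have "rho e v \<omega> < 3" using rho_permutes[OF e that] \<omega> by (metis lessThan_iff permutes_in_image)
    then show ?thesis using that by (rule cfrac_hpart[rotated])
  qed
  ultimately show ?thesis by (simp add: whid_def)
qed

lemma sum_whid_hpart:
  assumes e: "e \<in> E" and \<omega>: "\<omega> < 3"
  shows "(\<Sum>l<k. whid s e \<omega> (hpart s l)) = 1"
proof -
  have "(\<Sum>l<k. \<Sum>i<k. U e i * of_bool (i = l)) = (\<Sum>i<k. U e i * (\<Sum>l<k. of_bool (i = l)))"
    unfolding sum_distrib_left by (rule sum.swap)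
  also have "\<dots> = (\<Sum>i<k. U e i)" by (intro sum.cong) (auto simp: of_bool_def)
  finally have 1: "(\<Sum>l<k. \<Sum>i<k. U e i * of_bool (i = l)) = (\<Sum>i<k. U e i)" .
  have "(\<Sum>l<k. \<Sum>v\<in>Pt. W e v * of_bool (lab v (rho e v \<omega>) = l))
      = (\<Sum>v\<in>Pt. W e v * (\<Sum>l<k. of_bool (lab v (rho e v \<omega>) = l)))"
    unfolding sum_distrib_left by (rule sum.swap)
  also have "\<dots> = (\<Sum>v\<in>Pt. W e v)"
  proof (intro sum.cong refl)
    fix v assume v: "v \<in> Pt"
    have "rho e v \<omega> < 3" using rho_permutes[OF e v] \<omega> by (metis lessThan_iff permutes_in_image)
    then have "lab v (rho e v \<omega>) < k" using lab_less v by blast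
    then show "W e v * (\<Sum>l<k. of_bool (lab v (rho e v \<omega>) = l)) = W e v"
      by (simp add: of_bool_def)
  qed
  finally have 2: "(\<Sum>l<k. \<Sum>v\<in>Pt. W e v * of_bool (lab v (rho e v \<omega>) = l)) = (\<Sum>v\<in>Pt. W e v)" .
  show ?thesis
    by (simp only: whid_hpart[OF e \<omega>] sum.distrib 1 2 weight_sum[OF e])
qed

lemma hat_whid_hpart_unanimous:
  assumes e: "e \<in> E" and \<omega>: "\<omega> < 2" and l: "l < k"
  shows "hat (whid s e \<omega> (hpart s l)) = 0"
proof -
  have \<omega>3: "\<omega> < 3" using \<omega> by simp
  obtain c where c: "c < k" "\<And>i. i < k \<Longrightarrow> U e i > 0 \<Longrightarrow> i = c"
    "\<And>v. v \<in> Pt \<Longrightarrow> W e v > 0 \<Longrightarrow> lab v (rho e v \<omega>) = c"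
    using unanimous[OF e \<omega>] by blast
  have 0: "whid s e \<omega> (hpart s l') = 0" if "l' \<noteq> c" for l'
  proof -
    have U0: "U e i * of_bool (i = l') = 0" if "i < k" for i
      using c(2)[OF that] U_nonneg[OF e, of i] \<open>l' \<noteq> c\<close> by (cases "U e i > 0") auto
    have W0: "W e v * of_bool (lab v (rho e v \<omega>) = l') = 0" if "v \<in> Pt" for v
      using c(3)[OF that] W_nonneg[OF e, of v] \<open>l' \<noteq> c\<close> by (cases "W e v > 0") auto
    have "(\<Sum>i<k. U e i * of_bool (i = l')) = 0"
      by (rule sum.neutral) (use U0 in blast)
    moreover have "(\<Sum>v\<in>Pt. W e v * of_bool (lab v (rho e v \<omega>) = l')) = 0"
      by (rule sum.neutral) (use W0 in blast)
    ultimately show ?thesis by (simp only: whid_hpart[OF e \<omega>3] add_0)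
  qed
  have "(\<Sum>l'<k. whid s e \<omega> (hpart s l')) = (\<Sum>l'\<in>{c}. whid s e \<omega> (hpart s l'))"
    by (rule sum.mono_neutral_right) (use c(1) 0 in auto)
  then have "whid s e \<omega> (hpart s c) = 1" using sum_whid_hpart[OF e \<omega>3] by simp
  then show ?thesis using 0[of l] by (cases "l = c") (auto simp: hat_def)
qed

lemma part_cost_hid: "part_cost k n (F s) (hid s) \<le> 1 + 18 * \<delta> * k"
proof -
  have *: "(\<Sum>l<k. ghid s e (hpart s l) + ghid s e ({..<n} - hpart s l) - 3/2) \<le> 1 + 18 * \<delta> * k"
    if e: "e \<in> E" for e
  proof -
    have "(\<Sum>l<k. ghid s e (hpart s l) + ghid s e ({..<n} - hpart s l) - 3/2)
       \<le> (\<Sum>l<k. whid s e 2 (hpart s l) + 18 * \<delta>)"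
    proof (rule sum_mono)
      fix l assume "l \<in> {..<k}"
      then have l: "l < k" by simp
      have "ghid s e (hpart s l) + ghid s e ({..<n} - hpart s l) - 3/2
          \<le> hat (whid s e 0 (hpart s l)) + hat (whid s e 1 (hpart s l))
            + hat (whid s e 2 (hpart s l)) + 18 * \<delta>"
        unfolding ghid_def sum_lessThan_3 whid_compl[OF e]
        by (rule truncation_le_hat[OF \<delta>_pos])
      also have "\<dots> \<le> whid s e 2 (hpart s l) + 18 * \<delta>"
        using hat_le[of "whid s e 2 (hpart s l)"]
        by (simp add: hat_whid_hpart_unanimous[OF e _ l])
      finally show "ghid s e (hpart s l) + ghid s e ({..<n} - hpart s l) - 3/2
          \<le> whid s e 2 (hpart s l) + 18 * \<delta>" .
    qed
    also have "\<dots> = 1 + 18 * \<delta> * k"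
      by (simp add: sum.distrib sum_whid_hpart[OF e])
    finally show ?thesis .
  qed
  have "part_cost k n (F s) (hid s)
      = (\<Sum>e\<in>E. mu e * (\<Sum>l<k. ghid s e (hpart s l) + ghid s e ({..<n} - hpart s l) - 3/2))"
    unfolding part_cost_def F_def sum_distrib_left hpart_def[symmetric] by (rule sum.swap)
  also have "\<dots> \<le> (\<Sum>e\<in>E. mu e * (1 + 18 * \<delta> * k))"
    by (intro sum_mono mult_left_mono * mu_nonneg)
  also have "\<dots> = 1 + 18 * \<delta> * k"
    by (simp only: sum_distrib_right[symmetric] mu_sum mult_1)
  finally show ?thesis .
qed

lemma part_cost_G:
  assumes gap: "\<And>y. (\<And>v l. v \<in> Pt \<Longrightarrow> y v l \<ge> 0) \<Longrightarrow> (\<And>v. v \<in> Pt \<Longrightarrow> (\<Sum>l<k. y v l) = 1) \<Longrightarrow>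
      \<tau> \<le> (\<Sum>e\<in>E. mu e * (\<Sum>l<k. hat (U e l + (\<Sum>v\<in>Pt. W e v * y v l))))"
    and v: "valid_partition k n (\<lambda>i. i) \<sigma>"
  shows "3 * \<tau> \<le> part_cost k n G \<sigma>"
proof -
  define A where "A = (\<lambda>l. {x \<in> {..<n}. \<sigma> x = l})"
  have kn: "k \<le> n" using size by simp
  have w: "wsym e (A l) = U e l + (\<Sum>v\<in>Pt. W e v * mfrac (A l) v)" if "l < k" for e l
  proof -
    have "(\<Sum>i<k. U e i * of_bool (i \<in> A l)) = (\<Sum>i<k. if i = l then U e i else 0)"
      using v kn by (intro sum.cong) (auto simp: valid_partition_def A_def)
    then show ?thesis using that by (simp add: wsym_def)
  qed
  have y1: "(\<Sum>l<k. mfrac (A l) v) = 1" if v': "v \<in> Pt" for v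
  proof -
    have 1: "(\<Sum>l<k. of_bool (cell v m a \<in> A l)) = (1::real)" if "m < L" "a < 3" for m a
    proof -
      have "cell v m a < n" "\<sigma> (cell v m a) < k"
        using cell_less[OF v' that] v by (auto simp: valid_partition_def)
      then show ?thesis by (simp add: of_bool_def A_def)
    qed
    have "(\<Sum>l<k. mfrac (A l) v)
      = (\<Sum>l<k. \<Sum>m<L. \<Sum>a<3. of_bool (cell v m a \<in> A l)) / (3 * L)"
      by (simp only: mfrac_def sum_divide_distrib)
    also have "(\<Sum>l<k. \<Sum>m<L. \<Sum>a<3. of_bool (cell v m a \<in> A l))
        = (\<Sum>m<L. \<Sum>l<k. \<Sum>a<3. of_bool (cell v m a \<in> A l) :: real)"
      by (rule sum.swap)
    also have "\<dots> = (\<Sum>m<L. \<Sum>a<3. \<Sum>l<k. of_bool (cell v m a \<in> A l))"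
      by (rule sum.cong[OF refl]) (rule sum.swap)
    also have "\<dots> = (\<Sum>m<L. \<Sum>a<(3::nat). 1)"
      by (intro sum.cong refl 1) auto
    finally show ?thesis using L_pos by simp
  qed
  have "\<tau> \<le> (\<Sum>e\<in>E. mu e * (\<Sum>l<k. hat (U e l + (\<Sum>v\<in>Pt. W e v * mfrac (A l) v))))"
    by (rule gap) (simp_all add: mfrac_nonneg y1)
  also have "\<dots> = (\<Sum>e\<in>E. mu e * (\<Sum>l<k. hat (wsym e (A l))))"
    by (intro sum.cong refl arg_cong2[where f = "(*)"]) (simp add: w)
  finally have "3 * \<tau> \<le> 3 * (\<Sum>e\<in>E. mu e * (\<Sum>l<k. hat (wsym e (A l))))" by simp
  also have "\<dots> = (\<Sum>e\<in>E. \<Sum>l<k. mu e * (3 * hat (wsym e (A l))))"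
    by (simp add: sum_distrib_left mult_ac)
  also have "\<dots> = part_cost k n G \<sigma>"
    unfolding part_cost_def G_eq A_def by (rule sum.swap)
  finally show ?thesis .
qed

definition shifts :: "('v \<times> nat \<Rightarrow> nat) pmf" where
  "shifts = Pi_pmf (Pt \<times> {..<L}) 0 (\<lambda>_. pmf_of_set {..<3})"

lemma finite_shifts: "finite (set_pmf shifts)"
proof -
  have "set_pmf shifts = PiE_dflt (Pt \<times> {..<L}) 0 (set_pmf \<circ> (\<lambda>_. pmf_of_set {..<3}))"
    unfolding shifts_def by (rule set_Pi_pmf) (simp add: finite_Pt)
  moreover have "finite \<dots>"
    by (rule finite_PiE_dflt) (auto simp: finite_Pt set_pmf_of_set lessThan_empty_iff)
  ultimately show ?thesis by simp
qed

lemma prob_cfrac: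
  assumes v: "v \<in> Pt"
  shows "measure_pmf.prob shifts {s. \<bar>cfrac s S v \<omega> - mfrac S v\<bar> > \<delta>} \<le> 2 * exp (-2 * \<delta>\<^sup>2 * L)"
proof -
  let ?X = "\<lambda>(v, m) r. of_bool (cell v m ((\<omega> + r) mod 3) \<in> S) :: real"
  let ?J = "{v} \<times> {..<L}"
  have "measure_pmf.prob shifts {s. \<bar>cfrac s S v \<omega> - mfrac S v\<bar> > \<delta>}
    \<le> measure_pmf.prob shifts {s. \<bar>(\<Sum>i\<in>?J. ?X i (s i))
        - (\<Sum>i\<in>?J. measure_pmf.expectation (pmf_of_set {..<3}) (?X i))\<bar> \<ge> \<delta> * card ?J}"
  proof (rule measure_pmf.finite_measure_mono)
    show "{s. \<bar>cfrac s S v \<omega> - mfrac S v\<bar> > \<delta>} \<subseteq> {s. \<bar>(\<Sum>i\<in>?J. ?X i (s i))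
        - (\<Sum>i\<in>?J. measure_pmf.expectation (pmf_of_set {..<3}) (?X i))\<bar> \<ge> \<delta> * card ?J}"
    proof (clarify)
      fix s assume s: "\<bar>cfrac s S v \<omega> - mfrac S v\<bar> > \<delta>"
      have J: "(\<Sum>i\<in>?J. h i) = (\<Sum>m<L. h (v, m))" for h :: "'v \<times> nat \<Rightarrow> real"
      proof -
        have "?J = Pair v ` {..<L}" by auto
        then show ?thesis by (simp only:) (subst sum.reindex, auto simp: inj_on_def)
      qed
      have 1: "(\<Sum>i\<in>?J. ?X i (s i)) = L * cfrac s S v \<omega>"
        unfolding J cfrac_def using L_pos by simp
      have ex: "measure_pmf.expectation (pmf_of_set {..<3}) (?X (v, m))
          = (\<Sum>a<3. of_bool (cell v m a \<in> S)) / 3" for m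
      proof -
        have "measure_pmf.expectation (pmf_of_set {..<3}) (?X (v, m)) = (\<Sum>r<3. ?X (v, m) r) / 3"
          by (subst integral_pmf_of_set) (auto simp: lessThan_empty_iff)
        also have "(\<Sum>r<3. ?X (v, m) r) = (\<Sum>a<3. of_bool (cell v m a \<in> S))"
          using sum_shift_mod3[of "\<lambda>a. of_bool (cell v m a \<in> S)" \<omega>] by (simp add: add.commute)
        finally show ?thesis .
      qed
      have 2: "(\<Sum>i\<in>?J. measure_pmf.expectation (pmf_of_set {..<3}) (?X i)) = L * mfrac S v"
        unfolding J ex mfrac_def sum_divide_distrib[symmetric] using L_pos by simp
      have "\<delta> * card ?J = L * \<delta>" by simp
      also have "\<dots> \<le> L * \<bar>cfrac s S v \<omega> - mfrac S v\<bar>" using s by (intro mult_left_mono) auto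
      also have "\<dots> = \<bar>L * cfrac s S v \<omega> - L * mfrac S v\<bar>"
        by (simp add: abs_mult right_diff_distrib[symmetric])
      finally show "\<delta> * card ?J \<le> \<bar>(\<Sum>i\<in>?J. ?X i (s i))
        - (\<Sum>i\<in>?J. measure_pmf.expectation (pmf_of_set {..<3}) (?X i))\<bar>"
        unfolding 1 2 .
    qed
  qed simp
  also have "\<dots> \<le> 2 * exp (-2 * \<delta>\<^sup>2 * card ?J)"
    unfolding shifts_def
    by (rule Hoeffding_Pi_pmf) (use v L_pos \<delta>_pos finite_Pt in \<open>auto simp: of_bool_def\<close>)
  finally show ?thesis by simp
qed

lemma prob_balanced:
  "measure_pmf.prob shifts {s. \<not> balanced s S} \<le> 6 * card Pt * exp (-2 * \<delta>\<^sup>2 * L)"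
proof -
  have eq: "{s. \<not> balanced s S} = (\<Union>(v, \<omega>)\<in>Pt \<times> {..<3}. {s. \<bar>cfrac s S v \<omega> - mfrac S v\<bar> > \<delta>})"
    by (auto simp: balanced_def not_le)
  have "measure_pmf.prob shifts {s. \<not> balanced s S}
     \<le> (\<Sum>x\<in>Pt \<times> {..<3}. measure_pmf.prob shifts (case x of (v, \<omega>) \<Rightarrow> {s. \<bar>cfrac s S v \<omega> - mfrac S v\<bar> > \<delta>}))"
    unfolding eq by (rule measure_pmf.finite_measure_subadditive_finite) (auto simp: finite_Pt)
  also have "\<dots> \<le> (\<Sum>x\<in>Pt \<times> {..<(3::nat)}. 2 * exp (-2 * \<delta>\<^sup>2 * L))"
    by (intro sum_mono) (auto simp: prob_cfrac[simplified])
  also have "\<dots> = 6 * card Pt * exp (-2 * \<delta>\<^sup>2 * L)"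
    by (simp add: card_cartesian_product)
  finally show ?thesis .
qed

end

context blowup
begin

lemma prob_unbalanced_any:
  assumes "finite X"
  shows "measure_pmf.prob shifts {s. \<exists>S\<in>X. \<not> balanced s S}
    \<le> card X * (6 * card Pt * exp (-2 * \<delta>\<^sup>2 * L))"
proof -
  have "{s. \<exists>S\<in>X. \<not> balanced s S} = (\<Union>S\<in>X. {s. \<not> balanced s S})" by auto
  then have "measure_pmf.prob shifts {s. \<exists>S\<in>X. \<not> balanced s S}
      \<le> (\<Sum>S\<in>X. measure_pmf.prob shifts {s. \<not> balanced s S})"
    using measure_pmf.finite_measure_subadditive_finite[of X "\<lambda>S. {s. \<not> balanced s S}" shifts]
    by (simp add: assms)
  also have "\<dots> \<le> (\<Sum>S\<in>X. 6 * card Pt * exp (-2 * \<delta>\<^sup>2 * L))"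
    by (rule sum_mono) (rule prob_balanced)
  finally show ?thesis by simp
qed

lemma ratio_bound:
  fixes q \<tau> r \<epsilon> :: real
  assumes gap: "\<And>y. (\<And>v l. v \<in> Pt \<Longrightarrow> y v l \<ge> 0) \<Longrightarrow> (\<And>v. v \<in> Pt \<Longrightarrow> (\<Sum>l<k. y v l) = 1) \<Longrightarrow>
      \<tau> \<le> (\<Sum>e\<in>E. mu e * (\<Sum>l<k. hat (U e l + (\<Sum>v\<in>Pt. W e v * y v l))))"
    and \<tau>: "\<tau> \<ge> 0"
    and alg: "achieves_ratio k n r Alg"
    and nq: "\<And>T. T \<in> set_pmf (Alg (\<lambda>i. i)) \<Longrightarrow> real (num_queries G T) \<le> q"
    and \<epsilon>: "(q + k) * (6 * card Pt * exp (-2 * \<delta>\<^sup>2 * L)) \<le> \<epsilon>"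
  shows "(1 - \<epsilon>) * (3 * \<tau>) \<le> max r 0 * (1 + 18 * \<delta> * k)"
proof -
  define p where "p = Alg (\<lambda>i. i)"
  define c where "c = (\<lambda>s T. part_cost k n (F s) (run (F s) T))"
  have nonneg: "nonneg_on {..<n} (F s)" for s
    using valid_F unfolding valid_instance_def by blast
  have c0: "c s T \<ge> 0" for s T
    unfolding c_def by (rule part_cost_nonneg[OF nonneg])
  have c1: "c s T \<le> k * (3/2)" for s T
  proof -
    have "c s T \<le> (\<Sum>i<k. 3/2)"
      unfolding c_def part_cost_def by (rule sum_mono) (rule F_le)
    then show ?thesis by simp
  qed
  have int_p: "integrable (measure_pmf p) (c s)" for s
  proof (rule measure_pmf.integrable_const_bound[where B = "k * (3/2)"])
    have "norm (c s T) \<le> k * (3/2)" for T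
      using c1[of s T] by (simp only: real_norm_def abs_of_nonneg[OF c0])
    then show "AE T in measure_pmf p. norm (c s T) \<le> k * (3/2)" by (rule AE_I2)
  qed simp
  have avg: "(1 - \<epsilon>) * (3 * \<tau>) \<le> measure_pmf.expectation shifts (\<lambda>s. c s T)"
    if T: "T \<in> set_pmf p" for T
  proof -
    define \<sigma> where "\<sigma> = run G T"
    have v\<sigma>: "valid_partition k n (\<lambda>i. i) \<sigma>"
      using alg valid_G T unfolding achieves_ratio_def p_def \<sigma>_def by blast
    define X where "X = set (queries G T) \<union> (\<lambda>i. {v \<in> {..<n}. \<sigma> v = i}) ` {..<k}"
    have fX: "finite X" unfolding X_def by simp
    have "card X \<le> card (set (queries G T)) + card ((\<lambda>i. {v \<in> {..<n}. \<sigma> v = i}) ` {..<k})"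
      unfolding X_def by (rule card_Un_le)
    also have "\<dots> \<le> num_queries G T + k"
      using card_length[of "queries G T"] card_image_le[of "{..<k}" "\<lambda>i. {v \<in> {..<n}. \<sigma> v = i}"]
      by (simp add: length_queries)
    finally have cX: "real (card X) \<le> q + k"
      using nq[OF T[unfolded p_def]] by linarith
    let ?bad = "{s. \<exists>S\<in>X. \<not> balanced s S}"
    have "measure_pmf.prob shifts ?bad \<le> card X * (6 * card Pt * exp (-2 * \<delta>\<^sup>2 * L))"
      by (rule prob_unbalanced_any[OF fX])
    also have "\<dots> \<le> (q + k) * (6 * card Pt * exp (-2 * \<delta>\<^sup>2 * L))"
      using cX by (intro mult_right_mono) auto
    finally have bad: "measure_pmf.prob shifts ?bad \<le> \<epsilon>" using \<epsilon> by linarith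
    have good: "3 * \<tau> \<le> c s T" if "s \<notin> ?bad" for s
    proof -
      have bal: "balanced s S" if "S \<in> X" for S using \<open>s \<notin> ?bad\<close> that by auto
      have "run (F s) T = \<sigma>"
        unfolding \<sigma>_def by (rule run_cong) (auto intro!: F_balanced bal simp: X_def)
      moreover have "part_cost k n (F s) \<sigma> = part_cost k n G \<sigma>"
        unfolding part_cost_def by (intro sum.cong refl F_balanced bal) (auto simp: X_def)
      ultimately show ?thesis unfolding c_def using part_cost_G[OF gap v\<sigma>] by simp
    qed
    have "(1 - \<epsilon>) * (3 * \<tau>) \<le> (1 - measure_pmf.prob shifts ?bad) * (3 * \<tau>)"
      using bad \<tau> by (intro mult_right_mono) auto
    also have "\<dots> = measure_pmf.expectation shifts (\<lambda>s. 3 * \<tau> * indicator (- ?bad) s)"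
      using measure_pmf.prob_compl[of ?bad shifts] by (simp add: Compl_eq_Diff_UNIV mult.commute)
    also have "\<dots> \<le> measure_pmf.expectation shifts (\<lambda>s. c s T)"
    proof (rule integral_mono)
      show "integrable (measure_pmf shifts) (\<lambda>s. 3 * \<tau> * indicator (- ?bad) s)"
        by (rule integrable_measure_pmf_finite[OF finite_shifts])
      show "integrable (measure_pmf shifts) (\<lambda>s. c s T)"
        by (rule integrable_measure_pmf_finite[OF finite_shifts])
      show "3 * \<tau> * indicator (- ?bad) s \<le> c s T" for s
        using good[of s] c0[of s T] by (auto simp: indicator_def)
    qed
    finally show ?thesis .
  qed
  have shift_sum: "measure_pmf.expectation shifts h = (\<Sum>s\<in>set_pmf shifts. pmf shifts s * h s)"
    for h :: "('v \<times> nat \<Rightarrow> nat) \<Rightarrow> real"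
    by (subst integral_measure_pmf[OF finite_shifts]) auto
  have Ep: "measure_pmf.expectation p (c s) \<le> max r 0 * (1 + 18 * \<delta> * k)" for s
  proof -
    have opt: "0 \<le> opt_cost k n (\<lambda>i. i) (F s)" "opt_cost k n (\<lambda>i. i) (F s) \<le> 1 + 18 * \<delta> * k"
      using opt_cost_nonneg[OF nonneg valid_hid] order_trans[OF opt_cost_le[OF valid_hid] part_cost_hid]
      by auto
    have "measure_pmf.expectation p (c s) \<le> r * opt_cost k n (\<lambda>i. i) (F s)"
      using alg valid_F unfolding achieves_ratio_def p_def c_def by blast
    also have "\<dots> \<le> max r 0 * opt_cost k n (\<lambda>i. i) (F s)"
      using opt by (intro mult_right_mono) auto
    also have "\<dots> \<le> max r 0 * (1 + 18 * \<delta> * k)"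
      using opt by (intro mult_left_mono) auto
    finally show ?thesis .
  qed
  have "(1 - \<epsilon>) * (3 * \<tau>) \<le> measure_pmf.expectation p (\<lambda>T. measure_pmf.expectation shifts (\<lambda>s. c s T))"
  proof (rule measure_pmf.integral_ge_const)
    show "integrable (measure_pmf p) (\<lambda>T. measure_pmf.expectation shifts (\<lambda>s. c s T))"
      unfolding shift_sum by (intro Bochner_Integration.integrable_sum integrable_mult_right int_p)
    show "AE T in measure_pmf p. (1 - \<epsilon>) * (3 * \<tau>) \<le> measure_pmf.expectation shifts (\<lambda>s. c s T)"
      using avg by (simp add: AE_measure_pmf_iff)
  qed
  also have "\<dots> = (\<Sum>s\<in>set_pmf shifts. pmf shifts s * measure_pmf.expectation p (c s))"
    unfolding shift_sum
    by (subst Bochner_Integration.integral_sum) (auto intro!: integrable_mult_right int_p)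
  also have "\<dots> \<le> (\<Sum>s\<in>set_pmf shifts. pmf shifts s * (max r 0 * (1 + 18 * \<delta> * k)))"
    by (intro sum_mono mult_left_mono Ep) auto
  also have "\<dots> = max r 0 * (1 + 18 * \<delta> * k)"
    unfolding sum_distrib_right[symmetric] by (simp add: sum_pmf_eq_1[OF finite_shifts])
  finally show ?thesis .
qed

end

theorem (in gap_instance) exponentially_many_queries:
  fixes \<tau> r :: real
  assumes gap: "\<And>y. (\<And>v l. v \<in> Pt \<Longrightarrow> y v l \<ge> 0) \<Longrightarrow> (\<And>v. v \<in> Pt \<Longrightarrow> (\<Sum>l<k. y v l) = 1) \<Longrightarrow>
      \<tau> \<le> (\<Sum>e\<in>E. mu e * (\<Sum>l<k. hat (U e l + (\<Sum>v\<in>Pt. W e v * y v l))))"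
    and \<tau>: "\<tau> > 0" and r: "r < 3 * \<tau>"
  shows "\<exists>c>0. \<exists>N. \<forall>n\<ge>N. \<forall>Alg. achieves_ratio k n r Alg \<longrightarrow>
     (\<exists>t f. valid_instance k n t f \<and>
        (\<exists>T\<in>set_pmf (Alg t). 2 powr (c * real n) \<le> real (num_queries f T)))"
proof -
  define R where "R = max r 0"
  have R: "R \<ge> 0" "R < 3 * \<tau>" using \<tau> r by (auto simp: R_def)
  define \<delta> where "\<delta> = (3 * \<tau> - R) / (72 * \<tau> * k)"
  have \<delta>: "\<delta> > 0" using R \<tau> k_pos by (simp add: \<delta>_def)
  define \<epsilon> where "\<epsilon> = (3 * \<tau> - R) / (24 * \<tau>)"
  have e: "\<epsilon> > 0" using R \<tau> by (simp add: \<epsilon>_def)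
  have "18 * \<delta> * k = (3 * \<tau> - R) / (4 * \<tau>)" using k_pos \<tau> by (simp add: \<delta>_def field_simps)
  then have "R * (1 + 18 * \<delta> * k) \<le> R + (3 * \<tau>) * ((3 * \<tau> - R) / (4 * \<tau>))"
    using mult_right_mono[of R "3 * \<tau>" "(3 * \<tau> - R) / (4 * \<tau>)"] R \<tau> by (simp add: distrib_left)
  also have "\<dots> = R + 3/4 * (3 * \<tau> - R)" using \<tau> by simp
  also have "\<dots> < 3 * \<tau> - (3 * \<tau> - R) / 8" using R by (simp add: field_simps)
  also have "\<dots> = (1 - \<epsilon>) * (3 * \<tau>)" using \<tau> by (simp add: \<epsilon>_def field_simps)
  finally have strict: "R * (1 + 18 * \<delta> * k) < (1 - \<epsilon>) * (3 * \<tau>)" .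
  define M where "M = 3 * card Pt + 3"
  define a where "a = 2 * \<delta>\<^sup>2 / M"
  have a: "a > 0" using \<delta> by (simp add: a_def M_def)
  define c where "c = a / (2 * ln 2)"
  have c: "c > 0" using a by (simp add: c_def)
  define C where "C = 6 * real (card Pt) * exp (a * (k + M))"
  have "(\<lambda>n::nat. (exp (a / 2 * n) + k) * (C * exp (- a * n))) \<longlonglongrightarrow> 0"
    using a by real_asymp
  then have "eventually (\<lambda>n. (exp (a / 2 * n) + k) * (C * exp (- a * n)) < \<epsilon>) sequentially"
    using e by (rule order_tendstoD)
  moreover have "eventually (\<lambda>n. n \<ge> k + M) sequentially" by (rule eventually_ge_at_top)
  ultimately have "eventually (\<lambda>n. (exp (a / 2 * n) + k) * (C * exp (- a * n)) < \<epsilon> \<and> n \<ge> k + M) sequentially"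
    by (rule eventually_conj)
  then obtain N :: nat where N: "\<And>n. n \<ge> N \<Longrightarrow> (exp (a / 2 * real n) + k) * (C * exp (- a * real n)) < \<epsilon> \<and> n \<ge> k + M"
    unfolding eventually_sequentially by blast
  show ?thesis
  proof (intro exI[of _ c] conjI c exI[of _ N] allI impI)
    fix n Alg assume n: "n \<ge> N" and alg: "achieves_ratio k n r Alg"
    define L where "L = (n - k) div M"
    obtain idx where idx: "bij_betw idx Pt {0..<card Pt}"
      using ex_bij_betw_finite_nat[OF finite_Pt] by blast
    have nM: "k + M \<le> n" using N[OF n] by (rule conjunct2)
    have "3 * card Pt * L \<le> M * L" by (simp add: M_def)
    also have "\<dots> \<le> n - k" unfolding L_def by simp
    finally have size: "k + 3 * card Pt * L \<le> n" using nM by linarith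
    have Lp: "L > 0" unfolding L_def using nM by (simp add: M_def div_greater_zero_iff)
    interpret blowup k Pt lab E mu U W rho n L idx \<delta>
    proof
      show "inj_on idx Pt" using idx by (rule bij_betw_imp_inj_on)
      show "idx v < card Pt" if "v \<in> Pt" for v using bij_betwE[OF idx] that by auto
    qed (use Lp \<delta> size in auto)
    have "n - k = M * L + (n - k) mod M" unfolding L_def by simp
    moreover have "(n - k) mod M < M" by (simp add: M_def)
    ultimately have "n \<le> M * L + k + M" by linarith
    then have "real n \<le> real (M * L + k + M)" by (rule of_nat_mono)
    then have "real n \<le> M * real L + k + M" by simp
    then have "a * n \<le> a * (M * real L + k + M)" using a by (intro mult_left_mono) auto
    also have "\<dots> = 2 * \<delta>\<^sup>2 * L + a * (k + M)"
      by (simp add: a_def M_def field_simps)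
    finally have ex: "-2 * \<delta>\<^sup>2 * L \<le> a * (k + M) + - a * n" by simp
    have "6 * card Pt * exp (-2 * \<delta>\<^sup>2 * L) \<le> 6 * card Pt * exp (a * (k + M) + - a * n)"
      using ex by (intro mult_left_mono) auto
    also have "\<dots> = C * exp (- a * n)" by (simp add: C_def exp_add[symmetric])
    finally have ex2: "6 * card Pt * exp (-2 * \<delta>\<^sup>2 * L) \<le> C * exp (- a * n)" .
    have pw: "2 powr (c * n) = exp (a / 2 * n)" by (simp add: powr_def c_def)
    have small: "(2 powr (c * n) + k) * (6 * card Pt * exp (-2 * \<delta>\<^sup>2 * L)) \<le> \<epsilon>"
      using mult_left_mono[OF ex2, of "2 powr (c * n) + k"] N[OF n] by (simp add: pw)
    show "\<exists>t f. valid_instance k n t f \<and> (\<exists>T\<in>set_pmf (Alg t). 2 powr (c * real n) \<le> real (num_queries f T))"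
    proof (rule ccontr)
      assume neg: "\<not> ?thesis"
      have "(1 - \<epsilon>) * (3 * \<tau>) \<le> max r 0 * (1 + 18 * \<delta> * k)"
      proof (rule ratio_bound[OF gap _ alg _ small])
        show "0 \<le> \<tau>" using \<tau> by simp
        show "real (num_queries G T) \<le> 2 powr (c * real n)" if "T \<in> set_pmf (Alg (\<lambda>i. i))" for T
          using neg valid_G that by (meson linear)
      qed
      then show False using strict by (simp add: R_def)
    qed
  qed
qed

section \<open>A degree inequality for oriented graphs\<close>

text \<open>The left-hand side is not convex in a - b; the right-hand side is a piecewise linear convex
  majorant, whose hinges are the functions controlled by Landau's bound.\<close>

lemma degree_bound_pointwise_1:
  fixes a b :: real
  assumes "a \<ge> 0" "b \<ge> 0" "a + b \<le> 1"
  shows "(a + b) / 2 - 2/3 * b * (a + b)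
    \<le> (147/800) + (1/5) * (a - b) + (57/1000) * max 0 (a - b + (1/10)) + (257/5000) * max 0 (a - b - (1/5))
       + (1/40) * max 0 (a - b - (1/2))"
proof -
  define s where "s = a - b"
  define d where "d = a + b"
  have d: "d \<le> 1" "\<bar>s\<bar> \<le> d" using assms by (auto simp: s_def d_def)
  have eq: "(a + b) / 2 - 2/3 * b * (a + b) = d * (3 + 2 * s - 2 * d) / 6"
    by (simp add: s_def d_def field_simps)
  have "0 \<le> (3 + 2 * s - 4 * d)\<^sup>2" by simp
  then have q: "d * (3 + 2 * s - 2 * d) / 6 \<le> (3 + 2 * s)\<^sup>2 / 48"
    by (simp add: power2_eq_square field_simps)
  have chord: "(3 + 2 * s)\<^sup>2 / 48 \<le> c0 + c1 * s"
    if "x \<le> s" "s \<le> y" "(3 + 2 * x)\<^sup>2 / 48 \<le> c0 + c1 * x" "(3 + 2 * y)\<^sup>2 / 48 \<le> c0 + c1 * y" "x < y"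
    for x y c0 c1 :: real
  proof -
    have "(s - x) * ((3 + 2 * y)\<^sup>2 / 48) + (y - s) * ((3 + 2 * x)\<^sup>2 / 48)
        \<le> (s - x) * (c0 + c1 * y) + (y - s) * (c0 + c1 * x)"
      using that by (intro add_mono mult_left_mono) auto
    also have "\<dots> = (y - x) * (c0 + c1 * s)" by (simp add: algebra_simps)
    also have "(s - x) * ((3 + 2 * y)\<^sup>2 / 48) + (y - s) * ((3 + 2 * x)\<^sup>2 / 48)
        = (y - x) * ((3 + 2 * s)\<^sup>2 / 48) + (y - x) * ((s - x) * (y - s)) / 12"
      by (simp add: power2_eq_square field_simps)
    finally have "(y - x) * ((3 + 2 * s)\<^sup>2 / 48) + (y - x) * ((s - x) * (y - s)) / 12
       \<le> (y - x) * (c0 + c1 * s)" .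
    moreover have "0 \<le> (y - x) * ((s - x) * (y - s)) / 12" using that by simp
    ultimately have "(y - x) * ((3 + 2 * s)\<^sup>2 / 48) \<le> (y - x) * (c0 + c1 * s)" by linarith
    then show ?thesis using that by simp
  qed
  define z where "z = d * (3 + 2 * s - 2 * d) / 6"
  have q: "z \<le> (3 + 2 * s)\<^sup>2 / 48" using q by (simp only: z_def)
  consider "s < -(1/2)" | "-(1/2) \<le> s" "s \<le> -(1/10)" | "-(1/10) \<le> s" "s \<le> (1/5)" | "(1/5) \<le> s" "s \<le> (1/2)" | "(1/2) \<le> s"
    by linarith
  then have "z \<le> (147/800) + (1/5) * s + (57/1000) * max 0 (s + (1/10)) + (257/5000) * max 0 (s - (1/5)) + (1/40) * max 0 (s - (1/2))"
  proof cases
    case 1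
    have "(d + s) * (3 - 2 * d + 4 * s) \<le> 0"
      using 1 d by (intro mult_nonneg_nonpos) auto
    then have "d * (3 + 2 * s - 2 * d) \<le> - s * (3 + 4 * s)" by (simp add: algebra_simps)
    then have "z \<le> - s * (3 + 4 * s) / 6" by (simp add: z_def)
    moreover have "0 \<le> (s + (21/40))\<^sup>2" by simp
    then have "- s * (3 + 4 * s) / 6 \<le> (147/800) + (1/5) * s"
      by (simp add: power2_eq_square field_simps)
    ultimately show ?thesis using 1 by simp
  next
    case 2
    have "z \<le> (147/800) + (1/5) * s"
      by (rule order_trans[OF q chord[of "-(1/2)" "-(1/10)"]]) (use 2 in \<open>simp_all add: power2_eq_square\<close>)
    then show ?thesis using 2 by simp
  next
    case 3
    have "z \<le> (3789/20000) + (257/1000) * s"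
      by (rule order_trans[OF q chord[of "-(1/10)" "(1/5)"]]) (use 3 in \<open>simp_all add: power2_eq_square\<close>)
    then show ?thesis using 3 by (simp add: field_simps)
  next
    case 4
    have "z \<le> (17917/100000) + (771/2500) * s"
      by (rule order_trans[OF q chord[of "(1/5)" "(1/2)"]]) (use 4 in \<open>simp_all add: power2_eq_square\<close>)
    then show ?thesis using 4 by (simp add: field_simps)
  next
    case 5
    have "0 \<le> (1 - d) * (1 + 2 * s - 2 * d)" using 5 d by (intro mult_nonneg_nonneg) auto
    then have "d * (3 + 2 * s - 2 * d) \<le> 1 + 2 * s" by (simp add: algebra_simps)
    then have "z \<le> (1 + 2 * s) / 6" by (simp add: z_def)
    then show ?thesis using 5 by (simp add: field_simps)
  qed
  then show ?thesis unfolding eq s_def z_def d_def .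
qed

lemma degree_bound_pointwise_2:
  fixes a b :: real
  assumes "a \<ge> 0" "b \<ge> 0" "a + b \<le> 1"
  shows "(a + b) / 2 - 2/3 * b * (a + b) + (a + b) / 6 \<le> 1/3 + 1/4 * (a - b) + 1/12 * max 0 (a - b)"
proof -
  define s where "s = a - b"
  define d where "d = a + b"
  have d: "d \<le> 1" "\<bar>s\<bar> \<le> d" using assms by (auto simp: s_def d_def)
  have eq: "(a + b) / 2 - 2/3 * b * (a + b) + (a + b) / 6 = d * (2 + s - d) / 3"
    by (simp add: s_def d_def field_simps)
  have "d * (2 + s - d) / 3 \<le> 1/3 + 1/4 * s + 1/12 * max 0 s"
  proof (cases "s \<ge> 0")
    case True
    have "0 \<le> (1 - d) * (1 + s - d)" using True d by (intro mult_nonneg_nonneg) auto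
    then show ?thesis using True by (simp add: algebra_simps)
  next
    case False
    have "0 \<le> (2 + s - 2 * d)\<^sup>2" by simp
    then have "d * (2 + s - d) \<le> (2 + s)\<^sup>2 / 4" by (simp add: power2_eq_square field_simps)
    moreover have "s * (1 + s) \<le> 0" using False d by (intro mult_nonpos_nonneg) auto
    then have "(2 + s)\<^sup>2 / 12 \<le> 1/3 + 1/4 * s" by (simp add: power2_eq_square field_simps)
    ultimately show ?thesis using False by simp
  qed
  then show ?thesis unfolding eq s_def .
qed

lemma interpolate_bounds:
  fixes \<nu> G X :: real
  assumes \<nu>: "0 \<le> \<nu>" "\<nu> \<le> 1" and G: "G \<le> (527/2500)" and GX: "G + X / 6 \<le> 17/48" and X: "0 \<le> X" "X \<le> 1"
  shows "\<nu>\<^sup>2 * G + \<nu> * (1 - \<nu>) * X / 2 \<le> (132/625)"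
proof (cases "\<nu> \<ge> 3/4")
  case True
  have "\<nu>\<^sup>2 * G + \<nu> * (1 - \<nu>) * X / 2 = \<nu> * (4 * \<nu> - 3) * G + 3 * (\<nu> * (1 - \<nu>)) * (G + X / 6)"
    by (simp add: power2_eq_square field_simps)
  also have "\<dots> \<le> \<nu> * (4 * \<nu> - 3) * (527/2500) + 3 * (\<nu> * (1 - \<nu>)) * (17/48)"
    using True \<nu> G GX by (intro add_mono mult_left_mono mult_nonneg_nonneg) auto
  also have "\<dots> = (4301/10000) * \<nu> - (2193/10000) * \<nu>\<^sup>2" by (simp add: power2_eq_square field_simps)
  also have "\<dots> \<le> (132/625)"
  proof -
    have "0 \<le> (\<nu> - (49/50))\<^sup>2" by simp
    then have "(49/25) * \<nu> - (2401/2500) \<le> \<nu>\<^sup>2" by (simp add: power2_eq_square field_simps)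
    then have "(4301/10000) * \<nu> - (2193/10000) * \<nu>\<^sup>2 \<le> (4301/10000) * \<nu> - (2193/10000) * ((49/25) * \<nu> - (2401/2500))" by simp
    also have "\<dots> \<le> 132/625" using \<nu> by (simp add: field_simps)
    finally show ?thesis .
  qed
  finally show ?thesis .
next
  case False
  have "\<nu>\<^sup>2 * G + \<nu> * (1 - \<nu>) * X / 2 = \<nu>\<^sup>2 * (G + X / 6) + \<nu> * (1/2 - 2/3 * \<nu>) * X"
    by (simp add: power2_eq_square field_simps)
  also have "\<dots> \<le> \<nu>\<^sup>2 * (17/48) + \<nu> * (1/2 - 2/3 * \<nu>) * 1"
    using False \<nu> GX X by (intro add_mono mult_left_mono mult_nonneg_nonneg) auto
  also have "\<dots> = 1/2 * \<nu> - 5/16 * \<nu>\<^sup>2" by (simp add: power2_eq_square field_simps)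
  also have "\<dots> \<le> (132/625)"
  proof -
    have "0 \<le> (\<nu> - (4/5))\<^sup>2" by simp
    then show ?thesis by (simp add: power2_eq_square field_simps)
  qed
  finally show ?thesis .
qed

definition wins :: "(nat \<Rightarrow> nat \<Rightarrow> bool) \<Rightarrow> nat set \<Rightarrow> nat \<Rightarrow> real" where
  "wins R N v = (\<Sum>u\<in>N. of_bool (R v u))"

definition losses :: "(nat \<Rightarrow> nat \<Rightarrow> bool) \<Rightarrow> nat set \<Rightarrow> nat \<Rightarrow> real" where
  "losses R N v = (\<Sum>u\<in>N. of_bool (R u v))"

lemma wins_nonneg: "wins R N v \<ge> 0" and losses_nonneg: "losses R N v \<ge> 0"
  by (auto simp: wins_def losses_def intro: sum_nonneg)

lemma wins_losses_le:
  assumes "finite N" "asymp R"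
  shows "wins R N v + losses R N v \<le> card N"
proof -
  have "wins R N v + losses R N v = (\<Sum>u\<in>N. of_bool (R v u) + of_bool (R u v))"
    by (simp only: wins_def losses_def sum.distrib)
  also have "\<dots> \<le> (\<Sum>u\<in>N. 1)"
    using assms(2) by (intro sum_mono) (auto simp: of_bool_def dest: asympD)
  finally show ?thesis by simp
qed

lemma landau:
  assumes N: "finite N" and R: "asymp R" and S: "S \<subseteq> N"
  shows "(\<Sum>v\<in>S. wins R N v - losses R N v) \<le> real (card S) * (real (card N) - real (card S))"
proof -
  have fS: "finite S" using N S finite_subset by blast
  have "(\<Sum>v\<in>S. wins R N v - losses R N v) = (\<Sum>v\<in>S. \<Sum>u\<in>N. of_bool (R v u) - of_bool (R u v))"
    by (simp only: wins_def losses_def sum_subtractf)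
  also have "\<dots> = (\<Sum>v\<in>S. (\<Sum>u\<in>S. of_bool (R v u) - of_bool (R u v)) + (\<Sum>u\<in>N-S. of_bool (R v u) - of_bool (R u v)))"
    by (intro sum.cong refl, subst add.commute, rule sum.subset_diff[OF S N])
  also have "\<dots> = ((\<Sum>v\<in>S. \<Sum>u\<in>S. of_bool (R v u)) - (\<Sum>v\<in>S. \<Sum>u\<in>S. of_bool (R u v)))
      + (\<Sum>v\<in>S. \<Sum>u\<in>N-S. of_bool (R v u) - of_bool (R u v))"
    by (simp only: sum.distrib sum_subtractf)
  also have "(\<Sum>v\<in>S. \<Sum>u\<in>S. of_bool (R v u)) = (\<Sum>v\<in>S. \<Sum>u\<in>S. of_bool (R u v) :: real)"
    by (rule sum.swap)
  also have "(\<Sum>v\<in>S. \<Sum>u\<in>N-S. of_bool (R v u) - of_bool (R u v)) \<le> (\<Sum>v\<in>S. \<Sum>u\<in>N-S. (1::real))"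
    by (intro sum_mono) (auto simp: of_bool_def)
  also have "(\<Sum>v\<in>S. \<Sum>u\<in>N-S. (1::real)) = real (card S) * (real (card N) - real (card S))"
    using card_Diff_subset[OF fS S] card_mono[OF N S] by (simp add: of_nat_diff)
  finally show ?thesis by simp
qed

context
  fixes N :: "nat set" and R :: "nat \<Rightarrow> nat \<Rightarrow> bool" and n :: real and x y :: "nat \<Rightarrow> real"
  assumes N: "finite N" and R: "asymp R" and n: "n = card N" "n > 0"
  defines "x \<equiv> \<lambda>v. wins R N v / n" and "y \<equiv> \<lambda>v. losses R N v / n"
begin

lemma xy: "x v \<ge> 0" "y v \<ge> 0" "x v + y v \<le> 1"
  using wins_losses_le[OF N R, of v] n
  by (auto simp: x_def y_def wins_nonneg losses_nonneg add_divide_distrib[symmetric])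

lemma sum_score: "(\<Sum>v\<in>N. x v - y v) \<le> 0"
proof -
  have "(\<Sum>v\<in>N. x v - y v) = (\<Sum>v\<in>N. wins R N v - losses R N v) / n"
    by (simp add: x_def y_def diff_divide_distrib sum_divide_distrib sum_subtractf)
  then show ?thesis using landau[OF N R subset_refl] n by (simp add: divide_nonpos_pos)
qed

lemma hinge: "(\<Sum>v\<in>N. max 0 (x v - y v - \<sigma>)) \<le> (1 - \<sigma>)\<^sup>2 / 4 * n"
proof -
  define S where "S = {v \<in> N. x v - y v > \<sigma>}"
  define m where "m = real (card S)"
  have S: "S \<subseteq> N" by (auto simp: S_def)
  have "(\<Sum>v\<in>N. max 0 (x v - y v - \<sigma>)) = (\<Sum>v\<in>S. max 0 (x v - y v - \<sigma>))"
    by (rule sum.mono_neutral_right[OF N S]) (auto simp: S_def)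
  also have "\<dots> = (\<Sum>v\<in>S. (wins R N v - losses R N v) / n - \<sigma>)"
    by (rule sum.cong) (auto simp: S_def x_def y_def diff_divide_distrib)
  also have "\<dots> = (\<Sum>v\<in>S. wins R N v - losses R N v) / n - \<sigma> * m"
  proof -
    have "(\<Sum>v\<in>S. f v / n - \<sigma>) = (\<Sum>v\<in>S. f v) / n - \<sigma> * m" for f :: "nat \<Rightarrow> real"
      by (simp add: sum_subtractf sum_divide_distrib m_def)
    then show ?thesis .
  qed
  also have "\<dots> \<le> (m * (n - m)) / n - \<sigma> * m"
    using landau[OF N R S] n by (simp add: m_def divide_right_mono)
  also have "\<dots> \<le> (1 - \<sigma>)\<^sup>2 / 4 * n"
  proof -
    have "0 \<le> (n * (1 - \<sigma>) / 2 - m)\<^sup>2 / n" using n by simp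
    then show ?thesis using n(2) by (simp add: power2_eq_square field_simps)
  qed
  finally show ?thesis .
qed

lemma sum_bound_1: "(\<Sum>v\<in>N. (x v + y v) / 2 - 2/3 * y v * (x v + y v)) \<le> (527/2500) * n"
proof -
  have "(\<Sum>v\<in>N. (x v + y v) / 2 - 2/3 * y v * (x v + y v)) \<le> (\<Sum>v\<in>N. (147/800) + (1/5) * (x v - y v)
      + (57/1000) * max 0 (x v - y v + (1/10)) + (257/5000) * max 0 (x v - y v - (1/5)) + (1/40) * max 0 (x v - y v - (1/2)))"
    by (rule sum_mono) (rule degree_bound_pointwise_1[OF xy])
  also have "\<dots> = (147/800) * n + (1/5) * (\<Sum>v\<in>N. x v - y v) + (57/1000) * (\<Sum>v\<in>N. max 0 (x v - y v - (-(1/10))))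
     + (257/5000) * (\<Sum>v\<in>N. max 0 (x v - y v - (1/5))) + (1/40) * (\<Sum>v\<in>N. max 0 (x v - y v - (1/2)))"
    by (simp add: sum.distrib sum_distrib_left n)
  also have "\<dots> \<le> (147/800) * n + (1/5) * 0 + (57/1000) * ((1 - (-(1/10)))\<^sup>2 / 4 * n)
     + (257/5000) * ((1 - (1/5))\<^sup>2 / 4 * n) + (1/40) * ((1 - (1/2))\<^sup>2 / 4 * n)"
    by (intro add_mono mult_left_mono hinge sum_score order_refl) auto
  also have "\<dots> \<le> (527/2500) * n" using n by (simp add: power2_eq_square)
  finally show ?thesis .
qed

lemma sum_bound_2:
  "(\<Sum>v\<in>N. (x v + y v) / 2 - 2/3 * y v * (x v + y v)) + (\<Sum>v\<in>N. x v + y v) / 6 \<le> 17/48 * n"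
proof -
  have "(\<Sum>v\<in>N. (x v + y v) / 2 - 2/3 * y v * (x v + y v)) + (\<Sum>v\<in>N. x v + y v) / 6
     = (\<Sum>v\<in>N. (x v + y v) / 2 - 2/3 * y v * (x v + y v) + (x v + y v) / 6)"
    by (subst sum_divide_distrib) (rule sum.distrib[symmetric])
  also have "\<dots> \<le> (\<Sum>v\<in>N. 1/3 + 1/4 * (x v - y v) + 1/12 * max 0 (x v - y v))"
    by (rule sum_mono) (rule degree_bound_pointwise_2[OF xy])
  also have "\<dots> = 1/3 * n + 1/4 * (\<Sum>v\<in>N. x v - y v) + 1/12 * (\<Sum>v\<in>N. max 0 (x v - y v - 0))"
    by (simp add: sum.distrib sum_distrib_left n)
  also have "\<dots> \<le> 1/3 * n + 1/4 * 0 + 1/12 * ((1 - 0)\<^sup>2 / 4 * n)"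
    by (intro add_mono mult_left_mono hinge sum_score order_refl) auto
  also have "\<dots> = 17/48 * n" by simp
  finally show ?thesis .
qed

lemma sum_bound_scaled:
  assumes "n \<le> k"
  shows "(\<Sum>v\<in>N. (wins R N v + losses R N v) / (2 * k)
      - 2/3 * losses R N v * (wins R N v + losses R N v) / k\<^sup>2) \<le> (132/625) * n"
proof -
  define G where "G = (\<Sum>v\<in>N. (x v + y v) / 2 - 2/3 * y v * (x v + y v)) / n"
  define X where "X = (\<Sum>v\<in>N. x v + y v) / n"
  define \<nu> where "\<nu> = n / k"
  have k: "k > 0" using assms n by simp
  have "(\<Sum>v\<in>N. x v + y v) \<le> (\<Sum>v\<in>N. 1)" by (rule sum_mono) (rule xy)
  then have "(\<Sum>v\<in>N. x v + y v) \<le> n" using n by simp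
  then have X: "0 \<le> X" "X \<le> 1" using n xy by (auto simp: X_def sum_nonneg)
  have G: "G \<le> (527/2500)" using sum_bound_1 n unfolding G_def by (simp add: divide_le_eq)
  have "G + X / 6 = ((\<Sum>v\<in>N. (x v + y v) / 2 - 2/3 * y v * (x v + y v)) + (\<Sum>v\<in>N. x v + y v) / 6) / n"
    by (simp add: G_def X_def add_divide_distrib)
  also have "\<dots> \<le> 17/48" using sum_bound_2 n by (simp only: pos_divide_le_eq)
  finally have GX: "G + X / 6 \<le> 17/48" .
  have eq: "(wins R N v + losses R N v) / (2 * k) - 2/3 * losses R N v * (wins R N v + losses R N v) / k\<^sup>2
      = \<nu>\<^sup>2 * ((x v + y v) / 2 - 2/3 * y v * (x v + y v)) + \<nu> * (1 - \<nu>) / 2 * (x v + y v)" for v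
  proof -
    have w: "wins R N v = n * x v" "losses R N v = n * y v" using n by (auto simp: x_def y_def)
    show ?thesis unfolding w \<nu>_def using k by (simp add: power2_eq_square field_simps)
  qed
  have lin: "(\<Sum>v\<in>N. c * f v + c' * h v) = c * (\<Sum>v\<in>N. f v) + c' * (\<Sum>v\<in>N. h v)"
    for c c' :: real and f h by (simp add: sum.distrib sum_distrib_left)
  have "(\<Sum>v\<in>N. (wins R N v + losses R N v) / (2 * k)
      - 2/3 * losses R N v * (wins R N v + losses R N v) / k\<^sup>2)
    = \<nu>\<^sup>2 * (\<Sum>v\<in>N. (x v + y v) / 2 - 2/3 * y v * (x v + y v)) + \<nu> * (1 - \<nu>) / 2 * (\<Sum>v\<in>N. x v + y v)"
    unfolding eq by (rule lin)
  also have "\<dots> = (\<nu>\<^sup>2 * G + \<nu> * (1 - \<nu>) * X / 2) * n"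
    using n by (simp add: G_def X_def field_simps)
  also have "\<dots> \<le> (132/625) * n"
    using assms n k by (intro mult_right_mono interpolate_bounds G GX X) (auto simp: \<nu>_def)
  finally show ?thesis .
qed

end

lemma sum_wins_losses_swap:
  "(\<Sum>v\<in>N. wins R Z v + losses R Z v) = (\<Sum>v\<in>Z. wins R N v + losses R N v)"
proof -
  have "(\<Sum>v\<in>N. \<Sum>u\<in>Z. of_bool (R v u)) = (\<Sum>u\<in>Z. \<Sum>v\<in>N. of_bool (R v u) :: real)"
    "(\<Sum>v\<in>N. \<Sum>u\<in>Z. of_bool (R u v)) = (\<Sum>u\<in>Z. \<Sum>v\<in>N. of_bool (R u v) :: real)"
    by (rule sum.swap)+
  then show ?thesis by (simp only: wins_def losses_def sum.distrib add.commute)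
qed

text \<open>Vertices of low degree are the only ones that profit from free pairs. Edges between them
  and the remaining vertices may be discarded: such an edge costs its low end at least as much
  as its other end can gain from it.\<close>

lemma weighted_degree_bound:
  fixes p :: "nat \<Rightarrow> real" and k \<gamma> :: real
  assumes V: "finite V" and R: "asymp R" and k: "k = card V" "V \<noteq> {}"
    and p: "\<And>v. v \<in> V \<Longrightarrow> p v \<ge> 0" "\<And>v. v \<in> V \<Longrightarrow> wins R V v + losses R V v + p v \<le> k"
    and \<gamma>: "(132/625) \<le> \<gamma>" "\<gamma> \<le> 1/2"
  shows "(\<Sum>v\<in>V. (wins R V v + losses R V v) / (2 * k)
      - 2/3 * losses R V v * (wins R V v + losses R V v) / k\<^sup>2
      + \<gamma> * p v / k - (wins R V v + losses R V v) * p v / k\<^sup>2) \<le> \<gamma> * k"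
proof -
  define i where "i = (\<lambda>v. wins R V v / k)"
  define o' where "o' = (\<lambda>v. losses R V v / k)"
  define q where "q = (\<lambda>v. p v / k)"
  define d where "d = (\<lambda>v. i v + o' v)"
  have k0: "k > 0" using V k by (simp add: card_gt_0_iff)
  define T where "T = (\<lambda>v. d v / 2 - 2/3 * o' v * d v + \<gamma> * q v - d v * q v)"
  have T: "(wins R V v + losses R V v) / (2 * k)
      - 2/3 * losses R V v * (wins R V v + losses R V v) / k\<^sup>2
      + \<gamma> * p v / k - (wins R V v + losses R V v) * p v / k\<^sup>2 = T v" for v
    using k0 by (simp add: T_def d_def i_def o'_def q_def power2_eq_square field_simps)
  have io: "i v \<ge> 0" "o' v \<ge> 0" for v
    using k0 by (simp_all add: i_def o'_def wins_nonneg losses_nonneg)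
  have q: "q v \<ge> 0" "d v + q v \<le> 1" if "v \<in> V" for v
    using p[OF that] k0 by (auto simp: q_def d_def i_def o'_def add_divide_distrib[symmetric])
  define Z where "Z = {v \<in> V. d v < \<gamma>}"
  define N where "N = V - Z"
  have fin: "finite Z" "finite N" using V by (auto simp: Z_def N_def)
  have split: "wins R V v = wins R N v + wins R Z v" "losses R V v = losses R N v + losses R Z v" for v
    unfolding wins_def losses_def N_def
    by (rule sum.subset_diff; use V in \<open>auto simp: Z_def\<close>)+
  have TZ: "T v \<le> \<gamma> - d v / 2" if "v \<in> Z" for v
  proof -
    have v: "v \<in> V" "d v < \<gamma>" using that by (auto simp: Z_def)
    have d0: "d v \<ge> 0" using io by (simp add: d_def)
    have "(\<gamma> - d v) * q v \<le> (\<gamma> - d v) * (1 - d v)"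
      using v q[OF v(1)] by (intro mult_left_mono) auto
    moreover have "0 \<le> o' v * d v" using io d0 by simp
    moreover have "d v * d v \<le> d v * \<gamma>" using v d0 by (intro mult_left_mono) auto
    ultimately show ?thesis unfolding T_def by (simp add: algebra_simps)
  qed
  have TN: "T v \<le> ((wins R N v + losses R N v) / (2 * k)
      - 2/3 * losses R N v * (wins R N v + losses R N v) / k\<^sup>2) + (wins R Z v + losses R Z v) / (2 * k)"
    if "v \<in> N" for v
  proof -
    have v: "v \<in> V" "d v \<ge> \<gamma>" using that by (auto simp: Z_def N_def)
    have assoc: "2/3 * losses R N v * (wins R N v + losses R N v) / k\<^sup>2
        = 2/3 * (losses R N v * (wins R N v + losses R N v) / k\<^sup>2)"
      "2/3 * o' v * d v = 2/3 * (o' v * d v)" by simp_all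
    have "(\<gamma> - d v) * q v \<le> 0" using v q[OF v(1)] by (intro mult_nonpos_nonneg) auto
    then have "T v \<le> d v / 2 - 2/3 * o' v * d v" unfolding T_def by (simp add: algebra_simps)
    moreover have "losses R N v * (wins R N v + losses R N v) \<le> losses R V v * (wins R V v + losses R V v)"
      unfolding split using wins_nonneg losses_nonneg by (intro mult_mono) auto
    then have "losses R N v * (wins R N v + losses R N v) / k\<^sup>2
        \<le> losses R V v * (wins R V v + losses R V v) / k\<^sup>2"
      by (rule divide_right_mono) simp
    moreover have "losses R V v * (wins R V v + losses R V v) / k\<^sup>2 = o' v * d v"
      by (simp add: o'_def d_def i_def power2_eq_square add_divide_distrib[symmetric])
    moreover have "d v / 2 = (wins R N v + losses R N v) / (2 * k) + (wins R Z v + losses R Z v) / (2 * k)"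
      using k0 by (simp add: d_def i_def o'_def split field_simps)
    ultimately show ?thesis unfolding assoc by linarith
  qed
  have "(\<Sum>v\<in>V. T v) = (\<Sum>v\<in>N. T v) + (\<Sum>v\<in>Z. T v)"
    unfolding N_def using V by (intro sum.subset_diff) (auto simp: Z_def)
  also have "\<dots> \<le> (\<Sum>v\<in>N. ((wins R N v + losses R N v) / (2 * k)
      - 2/3 * losses R N v * (wins R N v + losses R N v) / k\<^sup>2) + (wins R Z v + losses R Z v) / (2 * k))
      + (\<Sum>v\<in>Z. \<gamma> - d v / 2)"
    by (intro add_mono sum_mono TN TZ)
  also have "\<dots> = (\<Sum>v\<in>N. (wins R N v + losses R N v) / (2 * k)
      - 2/3 * losses R N v * (wins R N v + losses R N v) / k\<^sup>2)
      + (\<Sum>v\<in>N. wins R Z v + losses R Z v) / (2 * k) + \<gamma> * card Z - (\<Sum>v\<in>Z. d v) / 2"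
  proof -
    have "(\<Sum>v\<in>N. f v + h v / (2 * k)) + (\<Sum>v\<in>Z. \<gamma> - d v / 2)
        = (\<Sum>v\<in>N. f v) + (\<Sum>v\<in>N. h v) / (2 * k) + \<gamma> * card Z - (\<Sum>v\<in>Z. d v) / 2" for f h
      by (simp add: sum.distrib sum_subtractf sum_divide_distrib)
    then show ?thesis .
  qed
  finally have 1: "(\<Sum>v\<in>V. T v) \<le> (\<Sum>v\<in>N. (wins R N v + losses R N v) / (2 * k)
      - 2/3 * losses R N v * (wins R N v + losses R N v) / k\<^sup>2)
      + (\<Sum>v\<in>N. wins R Z v + losses R Z v) / (2 * k) + \<gamma> * card Z - (\<Sum>v\<in>Z. d v) / 2" .
  have 2: "(\<Sum>v\<in>N. (wins R N v + losses R N v) / (2 * k)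
      - 2/3 * losses R N v * (wins R N v + losses R N v) / k\<^sup>2) \<le> \<gamma> * card N"
  proof (cases "N = {}")
    case False
    then have cN: "real (card N) > 0" using fin by (simp add: card_gt_0_iff)
    have "card N \<le> k" unfolding k(1) using V by (intro of_nat_mono card_mono) (auto simp: N_def)
    then have "(\<Sum>v\<in>N. (wins R N v + losses R N v) / (2 * k)
      - 2/3 * losses R N v * (wins R N v + losses R N v) / k\<^sup>2) \<le> (132/625) * real (card N)"
      by (intro sum_bound_scaled[OF fin(2) R refl cN]) simp
    also have "\<dots> \<le> \<gamma> * card N" using \<gamma> by (intro mult_right_mono) auto
    finally show ?thesis .
  qed simp
  have "(\<Sum>v\<in>N. wins R Z v + losses R Z v) \<le> (\<Sum>v\<in>Z. k * d v)"
  proof (subst sum_wins_losses_swap, rule sum_mono)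
    fix v
    have "k * d v = wins R V v + losses R V v" using k0 by (simp add: d_def i_def o'_def field_simps)
    then show "wins R N v + losses R N v \<le> k * d v"
      using split[of v] wins_nonneg[of R Z v] losses_nonneg[of R Z v] by linarith
  qed
  also have "(\<Sum>v\<in>Z. k * d v) = k * (\<Sum>v\<in>Z. d v)" by (rule sum_distrib_left[symmetric])
  finally have "(\<Sum>v\<in>N. wins R Z v + losses R Z v) / (2 * k) \<le> (\<Sum>v\<in>Z. d v) / 2"
    using k0 by (simp add: field_simps)
  then have "(\<Sum>v\<in>V. T v) \<le> \<gamma> * card N + \<gamma> * card Z" using 1 2 by linarith
  also have "\<dots> = \<gamma> * k"
    using card_Diff_subset[of Z V] fin V card_mono[of V Z] unfolding N_def k(1)
    by (simp add: Z_def of_nat_diff distrib_left[symmetric])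
  finally show ?thesis unfolding T .
qed

section \<open>Fractional labellings of the grid points\<close>

definition own :: "nat option \<Rightarrow> nat \<Rightarrow> real" where
  "own c u = of_bool (c = Some u)"

definition foreign :: "nat option \<Rightarrow> nat \<Rightarrow> nat \<Rightarrow> real" where
  "foreign c u v = of_bool (c \<noteq> None \<and> c \<noteq> Some u \<and> c \<noteq> Some v)"

definition gain :: "real \<Rightarrow> (nat \<Rightarrow> real) \<Rightarrow> nat option \<Rightarrow> nat \<Rightarrow> nat \<Rightarrow> real" where
  "gain \<gamma> Q c u v = (case c of None \<Rightarrow> 0 | Some z \<Rightarrow> Q z - (if z = u \<or> z = v then 1/2 else 1 - \<gamma>))"

text \<open>Each triple of pairs is charged to its three corners. For the two pairs at a corner, r, l and f
  indicate the colours: the corner itself, the other end of the pair, a foreign label.\<close>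

definition corner :: "real \<Rightarrow> real \<Rightarrow> real \<Rightarrow> real \<Rightarrow> real \<Rightarrow> real \<Rightarrow> real \<Rightarrow> real" where
  "corner \<gamma> r l f r' l' f' = (r + l + r' + l') / 4 - (r * l' + l * r') / 3 - 2/3 * (l * l')
     + \<gamma> / 2 * (f + f') - ((r + l) * f' + f * (r' + l')) / 2"

definition unit_triple :: "real \<Rightarrow> real \<Rightarrow> real \<Rightarrow> bool" where
  "unit_triple r l f \<longleftrightarrow> r = 0 \<and> l = 0 \<and> f = 0 \<or> r = 1 \<and> l = 0 \<and> f = 0 \<or> r = 0 \<and> l = 1 \<and> f = 0
     \<or> r = 0 \<and> l = 0 \<and> f = 1"

lemma corner_ge:
  assumes "unit_triple r l f" "unit_triple r' l' f'" "0 \<le> \<gamma>"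
  shows "corner \<gamma> r l f r' l' f' \<ge> - 1/2"
  using assms unfolding unit_triple_def corner_def
  by (elim disjE conjE) simp_all

lemma triple_arith:
  assumes "unit_triple a1 b1 f1" "unit_triple a2 b2 f2" "unit_triple a3 b3 f3"
    and "0 \<le> \<gamma>" "\<gamma> \<le> 1/2" "0 \<le> A" "0 \<le> B" "0 \<le> C" "0 \<le> p1" "0 \<le> p2" "0 \<le> p3"
    and "A + B + C + p1 \<le> 1" "A + B + C + p2 \<le> 1" "A + B + C + p3 \<le> 1"
  shows "(a1 * (A - 1/2) + b1 * (B - 1/2) + f1 * (p1 - (1 - \<gamma>)))
      + (a2 * (B - 1/2) + b2 * (C - 1/2) + f2 * (p2 - (1 - \<gamma>)))
      + (a3 * (C - 1/2) + b3 * (A - 1/2) + f3 * (p3 - (1 - \<gamma>)))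
    \<le> corner \<gamma> a1 b1 f1 b3 a3 f3 + corner \<gamma> a2 b2 f2 b1 a1 f1 + corner \<gamma> a3 b3 f3 b2 a2 f2"
  using assms unfolding unit_triple_def corner_def
  by (elim disjE conjE) simp_all

lemma triple_gain_le:
  fixes Q :: "nat \<Rightarrow> real"
  assumes d: "u \<noteq> v" "v \<noteq> w" "w \<noteq> u" and \<gamma>: "0 \<le> \<gamma>" "\<gamma> \<le> 1/2"
    and Q: "\<And>a. Q a \<ge> 0" "\<And>A. finite A \<Longrightarrow> sum Q A \<le> 1"
  shows "gain \<gamma> Q c1 u v + gain \<gamma> Q c2 v w + gain \<gamma> Q c3 w u
    \<le> corner \<gamma> (own c1 u) (own c1 v) (foreign c1 u v) (own c3 u) (own c3 w) (foreign c3 w u)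
      + corner \<gamma> (own c2 v) (own c2 w) (foreign c2 v w) (own c1 v) (own c1 u) (foreign c1 u v)
      + corner \<gamma> (own c3 w) (own c3 u) (foreign c3 w u) (own c2 w) (own c2 v) (foreign c2 v w)
      + 3 * (own c1 w + own c2 u + own c3 v)"
proof -
  have ut: "unit_triple (own c a) (own c b) (foreign c a b)" if "a \<noteq> b" for c a b
    using that by (cases c) (auto simp: unit_triple_def own_def foreign_def)
  note uts = ut[OF d(1), of c1] ut[OF d(2), of c2] ut[OF d(3), of c3]
  have ut': "unit_triple (own c a) (own c b) (foreign c b a)" if "a \<noteq> b" for c a b
    using that by (cases c) (auto simp: unit_triple_def own_def foreign_def)
  note uts' = ut'[OF d(1)[symmetric], of c1] ut'[OF d(2)[symmetric], of c2] ut'[OF d(3)[symmetric], of c3]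
  have own0: "own c a \<ge> 0" for c a by (simp add: own_def)
  show ?thesis
  proof (cases "c1 = Some w \<or> c2 = Some u \<or> c3 = Some v")
    case True
    have Q1: "Q a \<le> 1" for a using Q(2)[of "{a}"] by simp
    have g: "gain \<gamma> Q c a b \<le> 1/2" for c a b
      using \<gamma> Q1[of "the c"] by (cases c) (auto simp: gain_def)
    have "own c1 w + own c2 u + own c3 v \<ge> 1"
      using True own0[of c1 w] own0[of c2 u] own0[of c3 v] by (auto simp: own_def)
    moreover have "x1 + x2 + x3 \<le> y1 + y2 + y3 + 3 * t"
      if "1 \<le> t" "x1 \<le> 1/2" "x2 \<le> 1/2" "x3 \<le> 1/2" "- 1/2 \<le> y1" "- 1/2 \<le> y2" "- 1/2 \<le> y3"
      for x1 x2 x3 y1 y2 y3 t :: real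
      using that by linarith
    ultimately show ?thesis
      using corner_ge[OF uts(1) uts'(3) \<gamma>(1)] corner_ge[OF uts(2) uts'(1) \<gamma>(1)]
        corner_ge[OF uts(3) uts'(2) \<gamma>(1)] g by blast
  next
    case False
    define p where "p = (\<lambda>c a b. if foreign c a b = 1 then Q (the c) else 0)"
    have p0: "p c a b \<ge> 0" for c a b using Q by (simp add: p_def)
    have g: "gain \<gamma> Q c a b = own c a * (Q a - 1/2) + own c b * (Q b - 1/2)
        + foreign c a b * (p c a b - (1 - \<gamma>))" if "a \<noteq> b" for c a b
      using that by (cases c) (auto simp: gain_def own_def foreign_def p_def)
    have s3: "Q u + Q v + Q w \<le> 1" using Q(2)[of "{u, v, w}"] d by simp
    have s: "Q u + Q v + Q w + p c a b \<le> 1" if "c \<noteq> Some u" "c \<noteq> Some v" "c \<noteq> Some w" for c a b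
    proof (cases c)
      case None
      then show ?thesis using s3 by (simp add: p_def foreign_def)
    next
      case (Some z)
      then have z: "z \<noteq> u" "z \<noteq> v" "z \<noteq> w" using that by auto
      have "Q u + Q v + Q w + Q z \<le> 1" using Q(2)[of "{u, v, w, z}"] d z by (simp add: add.assoc)
      then show ?thesis using s3 Some by (simp add: p_def)
    qed
    have s': "Q u + Q v + Q w + p c a b \<le> 1" if "c \<noteq> Some x" "{a, b, x} = {u, v, w}" for c a b x
    proof (cases "c = Some a \<or> c = Some b")
      case True
      then show ?thesis using s3 by (auto simp: p_def foreign_def)
    next
      case False
      then have "c \<noteq> Some t" if "t \<in> {a, b, x}" for t using that \<open>c \<noteq> Some x\<close> by auto
      then show ?thesis by (intro s) (use that(2) in auto)
    qed
    have "gain \<gamma> Q c1 u v + gain \<gamma> Q c2 v w + gain \<gamma> Q c3 w u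
      \<le> corner \<gamma> (own c1 u) (own c1 v) (foreign c1 u v) (own c3 u) (own c3 w) (foreign c3 w u)
      + corner \<gamma> (own c2 v) (own c2 w) (foreign c2 v w) (own c1 v) (own c1 u) (foreign c1 u v)
      + corner \<gamma> (own c3 w) (own c3 u) (foreign c3 w u) (own c2 w) (own c2 v) (foreign c2 v w)"
      unfolding g[OF d(1)] g[OF d(2)] g[OF d(3)]
      by (rule triple_arith[OF uts \<gamma> Q(1) Q(1) Q(1) p0 p0 p0 s'[of c1 w] s'[of c2 u] s'[of c3 v]])
         (use False in auto)
    moreover have "own c1 w + own c2 u + own c3 v = 0" using False by (simp add: own_def)
    ultimately show ?thesis by (simp only: mult_zero_right add_0_right)
  qed
qed

lemma sum_hat:
  fixes w :: "nat \<Rightarrow> real"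
  assumes w: "\<And>l. l < k \<Longrightarrow> w l \<ge> 0" "(\<Sum>l<k. w l) = 1"
  shows "(\<And>l. l < k \<Longrightarrow> w l \<le> 1/2) \<Longrightarrow> (\<Sum>l<k. hat (w l)) = 1"
    and "z < k \<Longrightarrow> w z > 1/2 \<Longrightarrow> (\<Sum>l<k. hat (w l)) = 2 * (1 - w z)"
proof -
  assume "\<And>l. l < k \<Longrightarrow> w l \<le> 1/2"
  then have "hat (w l) = w l" if "l < k" for l using that by (force simp: hat_def)
  then have "(\<Sum>l<k. hat (w l)) = (\<Sum>l<k. w l)" by (intro sum.cong) auto
  then show "(\<Sum>l<k. hat (w l)) = 1" using w by simp
next
  assume z: "z < k" "w z > 1/2"
  have s: "(\<Sum>l<k. f l) = f z + (\<Sum>l\<in>{..<k} - {z}. f l)" for f :: "nat \<Rightarrow> real"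
    using z by (simp add: sum.remove)
  have "w l \<le> 1/2" if "l \<in> {..<k} - {z}" for l
  proof -
    have "w l \<le> (\<Sum>l\<in>{..<k} - {z}. w l)"
      using that w by (intro member_le_sum) auto
    then show ?thesis using s[of w] w z by simp
  qed
  then have "hat (w l) = w l" if "l \<in> {..<k} - {z}" for l using that by (force simp: hat_def)
  then have "(\<Sum>l\<in>{..<k} - {z}. hat (w l)) = (\<Sum>l\<in>{..<k} - {z}. w l)" by (intro sum.cong) auto
  moreover have "hat (w z) = 1 - w z" using z by (simp add: hat_def)
  ultimately show "(\<Sum>l<k. hat (w l)) = 2 * (1 - w z)" using s[of "\<lambda>l. hat (w l)"] s[of w] w by simp
qed

lemma sum_corner:
  fixes r l f :: "nat \<Rightarrow> real"
  assumes "finite V"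
  defines "I \<equiv> sum r V" and "O' \<equiv> sum l V" and "P \<equiv> sum f V" and "n \<equiv> real (card V)"
  shows "(\<Sum>v\<in>V. \<Sum>w\<in>V. corner \<gamma> (r v) (l v) (f v) (r w) (l w) (f w))
    = n * (I + O') / 2 - 2/3 * O' * (I + O') + \<gamma> * n * P - (I + O') * P"
proof -
  have lin: "(\<Sum>w\<in>V. c0 + c1 * r w + c2 * l w + c3 * f w) = c0 * n + c1 * I + c2 * O' + c3 * P" for c0 c1 c2 c3
    by (simp add: sum.distrib sum_distrib_left I_def O'_def P_def n_def)
  have c: "corner \<gamma> a b c (r w) (l w) (f w)
      = ((a + b) / 4 + \<gamma> / 2 * c) + (1/4 - b / 3 - c / 2) * r w + (1/4 - a / 3 - 2/3 * b - c / 2) * l w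
        + (\<gamma> / 2 - (a + b) / 2) * f w" for a b c w
    by (simp add: corner_def field_simps)
  have 1: "(\<Sum>w\<in>V. corner \<gamma> a b c (r w) (l w) (f w))
      = (I / 4 + O' / 4 + \<gamma> / 2 * P) + (n / 4 - O' / 3 - P / 2) * a
        + (n / 4 - I / 3 - 2/3 * O' - P / 2) * b + (\<gamma> / 2 * n - I / 2 - O' / 2) * c" for a b c
    unfolding c lin by (simp add: field_simps)
  show ?thesis unfolding 1 lin by (simp add: field_simps)
qed

text \<open>These are cw = alpha / (4 (1 - alpha)), bw = 1 - 2 cw, beta = 2 - 3 alpha and
  gam = (1 - 2 alpha) / beta, where alpha is the total weight of the hyperedges (i, i). The choice
  of cw makes it equally expensive to give a foreign label only to the points {i, j, r} with
  r distinct from i and j, or to all points of the hyperedge (i, j).\<close>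

definition alpha :: real where "alpha = 4227/10000"
definition cw :: real where "cw = 4227/23092"
definition bw :: real where "bw = 7319/11546"
definition beta :: real where "beta = 7319/10000"
definition gam :: real where "gam = 1546/7319"

locale labelling =
  fixes k :: nat and y :: "nat multiset \<Rightarrow> nat \<Rightarrow> real"
  assumes k_large: "k \<ge> 1000000"
    and y_nonneg: "\<And>a b c l. a < k \<Longrightarrow> b < k \<Longrightarrow> c < k \<Longrightarrow> y {#a, b, c#} l \<ge> 0"
    and y_sum: "\<And>a b c. a < k \<Longrightarrow> b < k \<Longrightarrow> c < k \<Longrightarrow> (\<Sum>l<k. y {#a, b, c#} l) = 1"
begin

definition q :: "nat \<Rightarrow> nat \<Rightarrow> nat \<Rightarrow> real" where
  "q i j l = (\<Sum>r\<in>{..<k} - {i, j}. y {#i, j, r#} l) / (real k - 2)"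

definition wt :: "nat \<Rightarrow> nat \<Rightarrow> nat \<Rightarrow> real" where
  "wt i j l = cw * y {#i, j, i#} l + cw * y {#i, j, j#} l + bw * q i j l"

definition col :: "nat \<Rightarrow> nat \<Rightarrow> nat option" where
  "col i j = (if \<exists>z<k. wt i j z > 1/2 then Some (SOME z. z < k \<and> wt i j z > 1/2) else None)"

text \<open>The cost of the hyperedge (i, j) together with the shares of (i, i) and (j, j) that are due to
  the points {i, i, j} and {i, j, j}.\<close>

definition pc :: "nat \<Rightarrow> nat \<Rightarrow> real" where
  "pc i j = alpha / 2 * ((1 - y {#i, i, j#} i) + (1 - y {#j, j, i#} j))
     + (1 - alpha) * (\<Sum>l<k. hat (wt i j l))"

definition Q :: "nat \<Rightarrow> nat \<Rightarrow> nat \<Rightarrow> nat \<Rightarrow> real" where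
  "Q i j r l = (if l < k then y {#i, j, r#} l else 0)"

definition xi :: "nat \<Rightarrow> nat \<Rightarrow> nat \<Rightarrow> real" where
  "xi i j r = gain gam (Q i j r) (col i j) i j"

lemma k2: "real k - 2 > 0" using k_large by simp

lemma card_other: "i < k \<Longrightarrow> j < k \<Longrightarrow> i \<noteq> j \<Longrightarrow> real (card ({..<k} - {i, j})) = real k - 2"
  using k_large by (simp add: card_Diff_subset of_nat_diff)

lemma q_sym: "q i j = q j i"
  unfolding q_def by (simp add: add_mset_commute insert_commute)

lemma wt_sym: "wt i j = wt j i"
  unfolding wt_def by (auto simp: q_sym[of i j] add_mset_commute)

lemma col_sym: "col i j = col j i"
  unfolding col_def wt_sym[of i j] ..

lemma y_le_1: "a < k \<Longrightarrow> b < k \<Longrightarrow> c < k \<Longrightarrow> l < k \<Longrightarrow> y {#a, b, c#} l \<le> 1"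
  using member_le_sum[of l "{..<k}" "y {#a, b, c#}"] y_sum[of a b c] y_nonneg[of a b c] by simp

lemma y_pair_le_1:
  assumes "a < k" "b < k" "c < k" "l < k" "l' < k" "l \<noteq> l'"
  shows "y {#a, b, c#} l + y {#a, b, c#} l' \<le> 1"
  using sum_mono2[of "{..<k}" "{l, l'}" "y {#a, b, c#}"] y_sum[of a b c] y_nonneg[of a b c] assms by simp

lemma Q_nonneg: "i < k \<Longrightarrow> j < k \<Longrightarrow> r < k \<Longrightarrow> Q i j r l \<ge> 0"
  by (simp add: Q_def y_nonneg)

lemma Q_sum_le:
  assumes "i < k" "j < k" "r < k" "finite A"
  shows "sum (Q i j r) A \<le> 1"
proof -
  have "sum (Q i j r) A \<le> sum (Q i j r) (A \<union> {..<k})"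
    using assms by (intro sum_mono2) (auto simp: Q_nonneg)
  also have "\<dots> = sum (Q i j r) {..<k}"
    using assms by (intro sum.mono_neutral_right) (auto simp: Q_def)
  also have "\<dots> = 1" using y_sum[OF assms(1-3)] by (simp add: Q_def)
  finally show ?thesis .
qed

lemma q_nonneg: "i < k \<Longrightarrow> j < k \<Longrightarrow> q i j l \<ge> 0"
  unfolding q_def using k2 by (intro divide_nonneg_nonneg sum_nonneg) (auto simp: y_nonneg)

lemma q_sum:
  assumes "i < k" "j < k" "i \<noteq> j"
  shows "(\<Sum>l<k. q i j l) = 1"
proof -
  have "(\<Sum>l<k. q i j l) = (\<Sum>l<k. \<Sum>r\<in>{..<k} - {i, j}. y {#i, j, r#} l) / (real k - 2)"
    by (simp only: q_def sum_divide_distrib)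
  also have "(\<Sum>l<k. \<Sum>r\<in>{..<k} - {i, j}. y {#i, j, r#} l) = (\<Sum>r\<in>{..<k} - {i, j}. \<Sum>l<k. y {#i, j, r#} l)"
    by (rule sum.swap)
  also have "\<dots> = (\<Sum>r\<in>{..<k} - {i, j}. 1)"
    by (intro sum.cong refl) (use assms y_sum in auto)
  finally show ?thesis using card_other[OF assms] k2 by simp
qed

lemma wt_nonneg: "i < k \<Longrightarrow> j < k \<Longrightarrow> wt i j l \<ge> 0"
  unfolding wt_def cw_def bw_def using y_nonneg q_nonneg by (intro add_nonneg_nonneg mult_nonneg_nonneg) auto

lemma wt_sum:
  assumes "i < k" "j < k" "i \<noteq> j"
  shows "(\<Sum>l<k. wt i j l) = 1"
proof -
  have "(\<Sum>l<k. wt i j l) = cw * (\<Sum>l<k. y {#i, j, i#} l) + cw * (\<Sum>l<k. y {#i, j, j#} l)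
      + bw * (\<Sum>l<k. q i j l)"
    by (simp only: wt_def sum.distrib sum_distrib_left)
  then show ?thesis using y_sum[of i j i] y_sum[of i j j] q_sum[of i j] assms
    by (simp add: cw_def bw_def)
qed

lemma col_SomeD:
  assumes "col i j = Some z"
  shows "z < k" "wt i j z > 1/2"
proof -
  have ex: "\<exists>z<k. wt i j z > 1/2" and z: "z = (SOME z. z < k \<and> wt i j z > 1/2)"
    using assms by (auto simp: col_def split: if_splits)
  have "z < k \<and> wt i j z > 1/2" unfolding z using ex by (rule someI_ex)
  then show "z < k" "wt i j z > 1/2" by auto
qed

lemma sum_xi:
  assumes "i < k" "j < k" "i \<noteq> j"
  shows "(\<Sum>r\<in>{..<k} - {i, j}. xi i j r) / (real k - 2)
    = (case col i j of None \<Rightarrow> 0 | Some z \<Rightarrow> q i j z - (if z = i \<or> z = j then 1/2 else 1 - gam))"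
proof (cases "col i j")
  case None
  then show ?thesis by (simp add: xi_def gain_def)
next
  case (Some z)
  define t where "t = (if z = i \<or> z = j then 1/2 else 1 - gam)"
  have z: "z < k" using col_SomeD[OF Some] by simp
  have "(\<Sum>r\<in>{..<k} - {i, j}. xi i j r) = (\<Sum>r\<in>{..<k} - {i, j}. y {#i, j, r#} z - t)"
    by (intro sum.cong refl) (simp add: xi_def gain_def Some Q_def z t_def)
  also have "\<dots> = (\<Sum>r\<in>{..<k} - {i, j}. y {#i, j, r#} z) - (real k - 2) * t"
    using card_other[OF assms] by (simp add: sum_subtractf)
  finally have "(\<Sum>r\<in>{..<k} - {i, j}. xi i j r) / (real k - 2) = q i j z - t"
    unfolding q_def using k2 by (simp add: diff_divide_distrib)
  then show ?thesis by (simp add: Some t_def)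
qed

lemma pc_ge_aux:
  assumes ij: "i < k" "j < k" "i \<noteq> j" and c: "wt i j i > 1/2"
  shows "pc i j \<ge> (1 - alpha) - beta * (q i j i - 1/2)"
proof -
  have h: "(\<Sum>l<k. hat (wt i j l)) = 2 * (1 - wt i j i)"
    by (rule sum_hat(2)) (use ij c wt_nonneg wt_sum in auto)
  have m: "{#i, j, i#} = {#i, i, j#}" "{#i, j, j#} = {#j, j, i#}" by (auto simp: add_mset_commute)
  have "y {#i, i, j#} i \<le> 1" "y {#j, j, i#} i + y {#j, j, i#} j \<le> 1"
    using y_le_1 y_pair_le_1 ij by auto
  then show ?thesis
    unfolding pc_def h unfolding wt_def m by (simp add: alpha_def cw_def bw_def beta_def field_simps)
qed

lemma pc_sym: "pc i j = pc j i"
  unfolding pc_def wt_sym[of i j] by (simp add: add.commute)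

lemma pc_ge:
  assumes ij: "i < k" "j < k" "i \<noteq> j"
  shows "pc i j \<ge> (1 - alpha) - beta * ((\<Sum>r\<in>{..<k} - {i, j}. xi i j r) / (real k - 2))"
proof (cases "col i j")
  case None
  then have "wt i j l \<le> 1/2" if "l < k" for l
    using that unfolding col_def by (metis not_less option.distinct(1))
  then have h: "(\<Sum>l<k. hat (wt i j l)) = 1"
    by (intro sum_hat(1)) (use ij wt_nonneg wt_sum in auto)
  have "0 \<le> (1 - y {#i, i, j#} i) + (1 - y {#j, j, i#} j)"
    using y_le_1[of i i j i] y_le_1[of j j i j] ij by simp
  then show ?thesis unfolding sum_xi[OF ij] None pc_def h by (simp add: alpha_def)
next
  case (Some z)
  note z = col_SomeD[OF Some]
  consider "z = i" | "z = j" | "z \<noteq> i" "z \<noteq> j" by blast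
  then show ?thesis
  proof cases
    case 1
    then show ?thesis using pc_ge_aux[OF ij] z by (simp add: sum_xi[OF ij] Some)
  next
    case 2
    then show ?thesis using pc_ge_aux[of j i] ij z
      by (simp add: sum_xi[OF ij] Some pc_sym[of i j] wt_sym[of i j] q_sym[of i j])
  next
    case 3
    have h: "(\<Sum>l<k. hat (wt i j l)) = 2 * (1 - wt i j z)"
      by (rule sum_hat(2)) (use ij z wt_nonneg wt_sum in auto)
    have m: "{#i, j, i#} = {#i, i, j#}" "{#i, j, j#} = {#j, j, i#}" by (auto simp: add_mset_commute)
    have "y {#i, i, j#} i + y {#i, i, j#} z \<le> 1" "y {#j, j, i#} j + y {#j, j, i#} z \<le> 1"
      using y_pair_le_1 ij z 3 by auto
    then have "pc i j \<ge> (1 - alpha) - beta * (q i j z - (1 - gam))"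
      unfolding pc_def h unfolding wt_def m by (simp add: alpha_def cw_def bw_def beta_def gam_def field_simps)
    then show ?thesis using 3 by (simp add: sum_xi[OF ij] Some)
  qed
qed

definition T :: "(nat \<times> nat \<times> nat) set" where
  "T = {(u, v, w). u < k \<and> v < k \<and> w < k \<and> u \<noteq> v \<and> v \<noteq> w \<and> w \<noteq> u}"

lemma sum_T: "(\<Sum>(u, v, w)\<in>T. h u v w) = (\<Sum>u<k. \<Sum>v\<in>{..<k} - {u}. \<Sum>w\<in>{..<k} - {u, v}. h u v w)"
  for h :: "nat \<Rightarrow> nat \<Rightarrow> nat \<Rightarrow> real"
proof -
  have "T = (SIGMA u:{..<k}. SIGMA v:{..<k} - {u}. {..<k} - {u, v})"
    by (auto simp: T_def)
  then show ?thesis by (simp add: sum.Sigma split_def)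
qed

lemma sum_T_rotate: "(\<Sum>(u, v, w)\<in>T. h v w u) = (\<Sum>(u, v, w)\<in>T. h u v w)"
  for h :: "nat \<Rightarrow> nat \<Rightarrow> nat \<Rightarrow> real"
  by (rule sum.reindex_bij_witness[where i = "\<lambda>(u, v, w). (w, u, v)" and j = "\<lambda>(u, v, w). (v, w, u)"])
     (auto simp: T_def)

lemma sum_T_rotate2: "(\<Sum>(u, v, w)\<in>T. h w u v) = (\<Sum>(u, v, w)\<in>T. h u v w)"
  for h :: "nat \<Rightarrow> nat \<Rightarrow> nat \<Rightarrow> real"
  using sum_T_rotate[of "\<lambda>u v w. h w u v"] by simp

definition beats :: "nat \<Rightarrow> nat \<Rightarrow> bool" where
  "beats u v \<longleftrightarrow> u < k \<and> v < k \<and> u \<noteq> v \<and> col u v = Some u"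

definition fr :: "nat \<Rightarrow> nat \<Rightarrow> real" where
  "fr u v = (if u = v then 0 else foreign (col u v) u v)"

lemma asymp_beats: "asymp beats"
  by (rule asympI) (auto simp: beats_def col_sym)

definition K :: "nat \<Rightarrow> nat \<Rightarrow> nat \<Rightarrow> real" where
  "K u v w = corner gam (own (col u v) u) (own (col u v) v) (foreign (col u v) u v)
     (own (col w u) u) (own (col w u) w) (foreign (col w u) w u)"

lemma sum_xi_le_sum_K:
  "(\<Sum>(u, v, w)\<in>T. xi u v w) \<le> (\<Sum>(u, v, w)\<in>T. K u v w) + 3 * (\<Sum>(u, v, w)\<in>T. own (col u v) w)"
proof -
  have "xi u v w + xi v w u + xi w u v
     \<le> K u v w + K v w u + K w u v + 3 * (own (col u v) w + own (col v w) u + own (col w u) v)"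
    if "(u, v, w) \<in> T" for u v w
  proof -
    have "Q v w u = Q u v w" "Q w u v = Q u v w" by (auto simp: Q_def add_mset_commute)
    moreover have "gain gam (Q u v w) (col u v) u v + gain gam (Q u v w) (col v w) v w + gain gam (Q u v w) (col w u) w u
       \<le> K u v w + K v w u + K w u v + 3 * (own (col u v) w + own (col v w) u + own (col w u) v)"
      unfolding K_def
      by (rule triple_gain_le) (use that in \<open>auto simp: T_def gam_def Q_nonneg Q_sum_le\<close>)
    ultimately show ?thesis by (simp add: xi_def)
  qed
  then have "(\<Sum>(u, v, w)\<in>T. xi u v w + xi v w u + xi w u v)
     \<le> (\<Sum>(u, v, w)\<in>T. K u v w + K v w u + K w u v + 3 * (own (col u v) w + own (col v w) u + own (col w u) v))"
    by (intro sum_mono) auto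
  moreover have "(\<Sum>(u, v, w)\<in>T. h u v w + h v w u + h w u v) = 3 * (\<Sum>(u, v, w)\<in>T. h u v w)"
    for h :: "nat \<Rightarrow> nat \<Rightarrow> nat \<Rightarrow> real"
    using sum_T_rotate[of h] sum_T_rotate2[of h] by (simp add: split_def sum.distrib)
  note this[of xi] this[of K] this[of "\<lambda>u v w. own (col u v) w"]
  moreover have "(\<Sum>(u, v, w)\<in>T. K u v w + K v w u + K w u v + 3 * (own (col u v) w + own (col v w) u + own (col w u) v))
     = (\<Sum>(u, v, w)\<in>T. K u v w + K v w u + K w u v)
       + 3 * (\<Sum>(u, v, w)\<in>T. own (col u v) w + own (col v w) u + own (col w u) v)"
    by (simp add: split_def sum.distrib sum_distrib_left[symmetric])
  ultimately show ?thesis by linarith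
qed

lemma sum_special: "(\<Sum>(u, v, w)\<in>T. own (col u v) w) \<le> (real k)\<^sup>2"
proof -
  have one: "(\<Sum>w\<in>A. own c w) \<le> 1" if "finite A" for A c
  proof (cases c)
    case None
    then show ?thesis by (simp add: own_def)
  next
    case (Some z)
    have "(\<Sum>w\<in>A. own c w) = (\<Sum>w\<in>A. if w = z then 1 else 0)"
      by (intro sum.cong) (auto simp: own_def Some)
    then show ?thesis using that by simp
  qed
  have "(\<Sum>(u, v, w)\<in>T. own (col u v) w) \<le> (\<Sum>u<k. \<Sum>v\<in>{..<k} - {u}. 1)"
    unfolding sum_T by (intro sum_mono one) auto
  also have "\<dots> \<le> (\<Sum>u<k. \<Sum>v<k. (1::real))"
    by (intro sum_mono sum_mono2) auto
  also have "\<dots> = (real k)\<^sup>2" by (simp add: power2_eq_square)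
  finally show ?thesis .
qed

lemma sum_K_le: "(\<Sum>(u, v, w)\<in>T. K u v w) \<le> gam * (real k)^3 + (real k)\<^sup>2"
proof -
  let ?V = "{..<k}"
  define p where "p = (\<lambda>u. \<Sum>v<k. fr u v)"
  define g where "g = (\<lambda>u v w. corner gam (of_bool (beats u v)) (of_bool (beats v u)) (fr u v)
       (of_bool (beats u w)) (of_bool (beats w u)) (fr u w))"
  have fr01: "fr u v = 0 \<or> fr u v = 1 \<and> \<not> beats u v \<and> \<not> beats v u" for u v
    by (auto simp: fr_def foreign_def beats_def col_sym[of v u])
  have asym: "\<not> (beats u v \<and> beats v u)" for u v using asymp_beats by (auto dest: asympD)
  have self: "\<not> beats u u" "fr u u = 0" for u by (auto simp: beats_def fr_def)
  have Kg: "K u v w = g u v w" if "(u, v, w) \<in> T" for u v w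
  proof -
    have "own (col u v) u = of_bool (beats u v)" "own (col u v) v = of_bool (beats v u)"
      "own (col w u) u = of_bool (beats u w)" "own (col w u) w = of_bool (beats w u)"
      "foreign (col u v) u v = fr u v" "foreign (col w u) w u = fr u w"
      using that by (auto simp: T_def own_def beats_def fr_def foreign_def col_sym[of w u] col_sym[of v u])
    then show ?thesis by (simp add: K_def g_def)
  qed
  have diag: "0 \<le> g u v v + 1" for u v
    using fr01[of u v] asym[of u v] by (auto simp: g_def corner_def gam_def)
  have left: "0 \<le> g u u w" for u w
    using fr01[of u w] asym[of u w] self[of u] by (auto simp: g_def corner_def gam_def)
  have right: "0 \<le> g u v u" for u v
    using fr01[of u v] asym[of u v] self[of u] by (auto simp: g_def corner_def gam_def)
  have "(\<Sum>(u, v, w)\<in>T. K u v w) = (\<Sum>(u, v, w)\<in>T. g u v w)"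
    by (intro sum.cong) (auto simp: Kg)
  also have "\<dots> \<le> (\<Sum>(u, v, w)\<in>T. g u v w + of_bool (v = w))"
    by (intro sum_mono) auto
  also have "\<dots> \<le> (\<Sum>(u, v, w)\<in>?V \<times> ?V \<times> ?V. g u v w + of_bool (v = w))"
  proof (intro sum_mono2)
    fix x assume "x \<in> ?V \<times> ?V \<times> ?V - T"
    then obtain u v w where x: "x = (u, v, w)" and "u = v \<or> v = w \<or> w = u"
      by (cases x) (auto simp: T_def)
    then show "0 \<le> (case x of (u, v, w) \<Rightarrow> g u v w + of_bool (v = w))"
      using diag[of u v] left[of u w] right[of u v] by (auto simp: x)
  qed (auto simp: T_def)
  also have "\<dots> = (\<Sum>u<k. (\<Sum>v<k. \<Sum>w<k. g u v w) + (\<Sum>v<k. \<Sum>w<k. of_bool (v = w)))"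
    by (simp add: sum.cartesian_product[symmetric] sum.distrib)
  also have "(\<Sum>v<k. \<Sum>w<k. of_bool (v = w)) = real k"
  proof -
    have "(\<Sum>w<k. of_bool (v = w)) = (1::real)" if "v \<in> {..<k}" for v
      using that by (simp add: of_bool_def)
    then show ?thesis by simp
  qed
  also have "(\<Sum>u<k. (\<Sum>v<k. \<Sum>w<k. g u v w) + real k)
    = (\<Sum>u<k. (real k)\<^sup>2 * ((wins beats ?V u + losses beats ?V u) / (2 * real k)
      - 2/3 * losses beats ?V u * (wins beats ?V u + losses beats ?V u) / (real k)\<^sup>2
      + gam * p u / real k - (wins beats ?V u + losses beats ?V u) * p u / (real k)\<^sup>2)) + (real k)\<^sup>2"
  proof -
    have "(\<Sum>v<k. \<Sum>w<k. g u v w) = (real k)\<^sup>2 * ((wins beats ?V u + losses beats ?V u) / (2 * real k)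
      - 2/3 * losses beats ?V u * (wins beats ?V u + losses beats ?V u) / (real k)\<^sup>2
      + gam * p u / real k - (wins beats ?V u + losses beats ?V u) * p u / (real k)\<^sup>2)" for u
    proof -
      have "(\<Sum>v<k. \<Sum>w<k. g u v w) = real k * (wins beats ?V u + losses beats ?V u) / 2
          - 2/3 * losses beats ?V u * (wins beats ?V u + losses beats ?V u)
          + gam * real k * p u - (wins beats ?V u + losses beats ?V u) * p u"
        unfolding g_def wins_def losses_def p_def by (subst sum_corner) simp_all
      moreover have "(real k)\<^sup>2 * (A / (2 * real k) - 2/3 * b * A / (real k)\<^sup>2 + gam * c / real k - A * c / (real k)\<^sup>2)
          = real k * A / 2 - 2/3 * b * A + gam * real k * c - A * c" for A b c :: real
        using k2 by (simp add: power2_eq_square field_simps)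
      ultimately show ?thesis by (simp only:)
    qed
    then show ?thesis by (simp add: sum.distrib power2_eq_square)
  qed
  also have "\<dots> \<le> (real k)\<^sup>2 * (gam * real k) + (real k)\<^sup>2"
    unfolding sum_distrib_left[symmetric]
  proof (intro add_mono mult_left_mono order_refl weighted_degree_bound)
    show "asymp beats" by (rule asymp_beats)
    show "{..<k} \<noteq> {}" using k_large by (auto simp: lessThan_empty_iff)
    show "0 \<le> p v" for v unfolding p_def by (intro sum_nonneg) (simp add: fr_def foreign_def)
    show "wins beats ?V v + losses beats ?V v + p v \<le> real k" for v
    proof -
      have "wins beats ?V v + losses beats ?V v + p v
          = (\<Sum>u<k. of_bool (beats v u) + of_bool (beats u v) + fr v u)"
        by (simp only: wins_def losses_def p_def sum.distrib)
      also have "\<dots> \<le> (\<Sum>u<k. 1)"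
      proof (rule sum_mono)
        fix u
        show "of_bool (beats v u) + of_bool (beats u v) + fr v u \<le> 1"
          using fr01[of v u] asym[of v u] by (auto simp: of_bool_def)
      qed
      finally show ?thesis by simp
    qed
  qed (auto simp: gam_def)
  also have "\<dots> = gam * (real k)^3 + (real k)\<^sup>2"
    by (simp add: power2_eq_square power3_eq_cube)
  finally show ?thesis .
qed

lemma sum_pc_ge:
  "1268/3000 * (real k * (real k - 1)) \<le> (\<Sum>i<k. \<Sum>j\<in>{..<k} - {i}. pc i j)"
proof -
  have X: "(\<Sum>(u, v, w)\<in>T. xi u v w) \<le> gam * (real k)^3 + 4 * (real k)\<^sup>2"
    using sum_xi_le_sum_K sum_K_le sum_special by linarith
  have card1: "real (card ({..<k} - {i})) = real k - 1" if "i < k" for i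
    using that by (simp add: of_nat_diff)
  have "(\<Sum>i<k. \<Sum>j\<in>{..<k} - {i}. pc i j)
     \<ge> (\<Sum>i<k. \<Sum>j\<in>{..<k} - {i}. (1 - alpha) - beta * ((\<Sum>r\<in>{..<k} - {i, j}. xi i j r) / (real k - 2)))"
    by (intro sum_mono pc_ge) auto
  moreover have "(\<Sum>i<k. \<Sum>j\<in>{..<k} - {i}. (1 - alpha) - beta * ((\<Sum>r\<in>{..<k} - {i, j}. xi i j r) / (real k - 2)))
     = (\<Sum>i<k. \<Sum>j\<in>{..<k} - {i}. (1 - alpha)) - beta / (real k - 2) * (\<Sum>(u, v, w)\<in>T. xi u v w)"
  proof -
    have "(1 - alpha) - beta * (c / (real k - 2)) = (1 - alpha) - beta / (real k - 2) * c" for c by simp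
    then show ?thesis unfolding sum_T by (simp only: sum_subtractf sum_distrib_left)
  qed
  moreover have "(\<Sum>i<k. \<Sum>j\<in>{..<k} - {i}. (1 - alpha)) = (1 - alpha) * (real k * (real k - 1))"
    by (simp add: card1)
  moreover have "beta / (real k - 2) * (\<Sum>(u, v, w)\<in>T. xi u v w)
      \<le> beta / (real k - 2) * (gam * (real k)^3 + 4 * (real k)\<^sup>2)"
    using X k2 by (intro mult_left_mono) (auto simp: beta_def)
  moreover have "1268/3000 * (real k * (real k - 1))
     \<le> (1 - alpha) * (real k * (real k - 1)) - beta / (real k - 2) * (gam * (real k)^3 + 4 * (real k)\<^sup>2)"
  proof -
    define x where "x = real k"
    have x: "x \<ge> 1000000" using k_large by (simp add: x_def)
    have "x * (x * 101745) \<le> x * (x * x)" using x by (intro mult_left_mono) auto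
    moreover have "0 \<le> x * 9278" using x by simp
    ultimately have "x * (x * 101745) \<le> x * (x * x) + x * 9278" by linarith
    then have "beta * (gam * x^3 + 4 * x\<^sup>2) \<le> (1 - alpha - 1268/3000) * (x * (x - 1)) * (x - 2)"
      using x by (simp add: beta_def gam_def alpha_def power2_eq_square power3_eq_cube algebra_simps)
    then have "beta / (x - 2) * (gam * x^3 + 4 * x\<^sup>2) \<le> (1 - alpha - 1268/3000) * (x * (x - 1))"
      using x by (simp add: divide_le_eq)
    then show ?thesis unfolding x_def[symmetric] by (simp add: left_diff_distrib)
  qed
  ultimately show ?thesis by linarith
qed

end

section \<open>The instance\<close>

definition points :: "nat \<Rightarrow> nat multiset set" where
  "points k = (\<lambda>(a, b, c). {#a, b, c#}) ` ({..<k} \<times> {..<k} \<times> {..<k})"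

definition label :: "nat multiset \<Rightarrow> nat \<Rightarrow> nat" where
  "label v \<omega> = sorted_list_of_multiset v ! \<omega>"

definition pw :: "nat \<Rightarrow> nat \<Rightarrow> nat \<Rightarrow> nat \<Rightarrow> real" where
  "pw k i j r = (if i = j then (if r = i then 0 else 1 / (2 * (real k - 1)))
     else if r = i \<or> r = j then cw else bw / (real k - 2))"

definition edge_weight :: "nat \<Rightarrow> nat \<times> nat \<Rightarrow> real" where
  "edge_weight k e = (if fst e = snd e then alpha / real k else (1 - alpha) / (real k * (real k - 1)))"

definition terminal_weight :: "nat \<times> nat \<Rightarrow> nat \<Rightarrow> real" where
  "terminal_weight e i = (if fst e = i \<and> snd e = i then 1/2 else 0)"

definition point_weight :: "nat \<Rightarrow> nat \<times> nat \<Rightarrow> nat multiset \<Rightarrow> real" where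
  "point_weight k e v = (\<Sum>r<k. pw k (fst e) (snd e) r * of_bool (v = {#fst e, snd e, r#}))"

definition roles :: "nat \<times> nat \<Rightarrow> nat multiset \<Rightarrow> nat \<Rightarrow> nat" where
  "roles e v = (SOME p. p permutes {..<3} \<and>
     (\<forall>r. v = {#fst e, snd e, r#} \<longrightarrow> label v (p 0) = fst e \<and> label v (p 1) = snd e))"

lemma finite_points: "finite (points k)"
  by (simp add: points_def)

lemma in_points: "a < k \<Longrightarrow> b < k \<Longrightarrow> c < k \<Longrightarrow> {#a, b, c#} \<in> points k"
  unfolding points_def by force

lemma label_less:
  assumes "v \<in> points k" "\<omega> < 3"
  shows "label v \<omega> < k"
proof -
  obtain a b c where v: "v = {#a, b, c#}" "a < k" "b < k" "c < k"
    using assms(1) by (auto simp: points_def)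
  have "length (sorted_list_of_multiset v) = 3"
    using size_mset[of "sorted_list_of_multiset v"] by (simp add: v)
  then have "label v \<omega> \<in> set (sorted_list_of_multiset v)"
    unfolding label_def using assms(2) by (intro nth_mem) simp
  then have "label v \<omega> \<in># v" by simp
  then show ?thesis using v by auto
qed

lemma roles: "roles e v permutes {..<3}"
  and label_roles: "v = {#fst e, snd e, r#} \<Longrightarrow> label v (roles e v 0) = fst e \<and> label v (roles e v 1) = snd e"
proof -
  have "\<exists>p. p permutes {..<3::nat} \<and>
     (\<forall>r. v = {#fst e, snd e, r#} \<longrightarrow> label v (p 0) = fst e \<and> label v (p 1) = snd e)"
  proof (cases "\<exists>r. v = {#fst e, snd e, r#}")
    case True
    then obtain r where v: "v = {#fst e, snd e, r#}" by blast
    define xs where "xs = sorted_list_of_multiset v"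
    have "mset [fst e, snd e, r] = mset xs" by (simp add: xs_def v)
    then obtain p where p: "p permutes {..<length xs}" "permute_list p xs = [fst e, snd e, r]"
      by (rule mset_eq_permutation)
    have len: "length xs = 3" using size_mset[of xs] by (simp add: xs_def v)
    have "xs ! p 0 = fst e" "xs ! p 1 = snd e"
      using permute_list_nth[OF p(1), of 0] permute_list_nth[OF p(1), of 1] p(2) len by auto
    then show ?thesis using p(1) len by (auto simp: label_def xs_def)
  next
    case False
    then show ?thesis using permutes_id by blast
  qed
  then have s: "roles e v permutes {..<3} \<and>
     (\<forall>r. v = {#fst e, snd e, r#} \<longrightarrow> label v (roles e v 0) = fst e \<and> label v (roles e v 1) = snd e)"
    unfolding roles_def by (rule someI_ex)
  then show "roles e v permutes {..<3}" ..
  show "v = {#fst e, snd e, r#} \<Longrightarrow> label v (roles e v 0) = fst e \<and> label v (roles e v 1) = snd e"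
    using s by blast
qed

lemma sum_point_weight:
  assumes "i < k" "j < k"
  shows "(\<Sum>v\<in>points k. point_weight k (i, j) v * h v) = (\<Sum>r<k. pw k i j r * h {#i, j, r#})"
proof -
  have "(\<Sum>v\<in>points k. point_weight k (i, j) v * h v)
     = (\<Sum>v\<in>points k. \<Sum>r<k. pw k i j r * (of_bool (v = {#i, j, r#}) * h v))"
    by (simp only: point_weight_def fst_conv snd_conv sum_distrib_right mult.assoc)
  also have "\<dots> = (\<Sum>r<k. \<Sum>v\<in>points k. pw k i j r * (of_bool (v = {#i, j, r#}) * h v))"
    by (rule sum.swap)
  also have "\<dots> = (\<Sum>r<k. pw k i j r * h {#i, j, r#})"
  proof (rule sum.cong[OF refl])
    fix r assume "r \<in> {..<k}"
    then have "{#i, j, r#} \<in> points k" using assms by (intro in_points) auto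
    moreover have "(\<Sum>v\<in>points k. pw k i j r * (of_bool (v = {#i, j, r#}) * h v))
        = (\<Sum>v\<in>points k. if v = {#i, j, r#} then pw k i j r * h v else 0)"
      by (rule sum.cong) auto
    ultimately show "(\<Sum>v\<in>points k. pw k i j r * (of_bool (v = {#i, j, r#}) * h v))
        = pw k i j r * h {#i, j, r#}"
      by (simp add: finite_points)
  qed
  finally show ?thesis .
qed

lemma sum_pw_diag:
  assumes "i < k"
  shows "(\<Sum>r<k. pw k i i r * h r) = (\<Sum>r\<in>{..<k} - {i}. h r) / (2 * (real k - 1))"
proof -
  have "(\<Sum>r<k. pw k i i r * h r) = (\<Sum>r\<in>{..<k} - {i}. pw k i i r * h r)"
    using assms by (simp add: sum.remove[of "{..<k}" i] pw_def)
  also have "\<dots> = (\<Sum>r\<in>{..<k} - {i}. h r / (2 * (real k - 1)))"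
    by (intro sum.cong) (auto simp: pw_def)
  finally show ?thesis by (simp add: sum_divide_distrib)
qed

lemma sum_pw_off_diag:
  assumes "i < k" "j < k" "i \<noteq> j"
  shows "(\<Sum>r<k. pw k i j r * h r) = cw * h i + cw * h j + bw * ((\<Sum>r\<in>{..<k} - {i, j}. h r) / (real k - 2))"
proof -
  have "(\<Sum>r<k. pw k i j r * h r) = pw k i j i * h i + (\<Sum>r\<in>{..<k} - {i}. pw k i j r * h r)"
    using assms by (simp add: sum.remove[of "{..<k}" i])
  also have "(\<Sum>r\<in>{..<k} - {i}. pw k i j r * h r) = pw k i j j * h j + (\<Sum>r\<in>{..<k} - {i} - {j}. pw k i j r * h r)"
    using assms by (intro sum.remove) auto
  also have "{..<k} - {i} - {j} = {..<k} - {i, j}" by auto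
  also have "(\<Sum>r\<in>{..<k} - {i, j}. pw k i j r * h r) = (\<Sum>r\<in>{..<k} - {i, j}. bw / (real k - 2) * h r)"
    using assms by (intro sum.cong) (auto simp: pw_def)
  also have "\<dots> = bw * ((\<Sum>r\<in>{..<k} - {i, j}. h r) / (real k - 2))"
    by (simp add: sum_distrib_left sum_divide_distrib)
  finally show ?thesis using assms by (simp add: pw_def)
qed

lemma pw_nonneg: "k \<ge> 1000000 \<Longrightarrow> pw k i j r \<ge> 0"
  by (auto simp: pw_def cw_def bw_def)

lemma gap_instance_points:
  assumes k: "k \<ge> 1000000"
  shows "gap_instance k (points k) label ({..<k} \<times> {..<k}) (edge_weight k) terminal_weight (point_weight k) roles"
proof
  show "0 < k" using k by simp
  show "finite (points k)" by (rule finite_points)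
  show "finite ({..<k} \<times> {..<k})" by simp
  show "0 \<le> edge_weight k e" for e using k by (simp add: edge_weight_def alpha_def)
  show "0 \<le> terminal_weight e i" for e i by (simp add: terminal_weight_def)
  show "0 \<le> point_weight k e v" for e v
    unfolding point_weight_def by (intro sum_nonneg mult_nonneg_nonneg pw_nonneg[OF k]) auto
  show "label v \<omega> < k" if "v \<in> points k" "\<omega> < 3" for v \<omega> using that by (rule label_less)
  show "roles e v permutes {..<3}" for e v by (rule roles)
  show "(\<Sum>e\<in>{..<k} \<times> {..<k}. edge_weight k e) = 1"
  proof -
    have "(\<Sum>e\<in>{..<k} \<times> {..<k}. edge_weight k e) = (\<Sum>i<k. \<Sum>j<k. edge_weight k (i, j))"
      by (simp add: sum.cartesian_product)
    also have "\<dots> = (\<Sum>i<k. alpha / real k + (\<Sum>j\<in>{..<k} - {i}. (1 - alpha) / (real k * (real k - 1))))"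
    proof (rule sum.cong[OF refl])
      fix i assume "i \<in> {..<k}"
      then have "(\<Sum>j<k. edge_weight k (i, j)) = edge_weight k (i, i) + (\<Sum>j\<in>{..<k} - {i}. edge_weight k (i, j))"
        by (intro sum.remove) auto
      also have "(\<Sum>j\<in>{..<k} - {i}. edge_weight k (i, j)) = (\<Sum>j\<in>{..<k} - {i}. (1 - alpha) / (real k * (real k - 1)))"
        by (rule sum.cong) (auto simp: edge_weight_def)
      finally show "(\<Sum>j<k. edge_weight k (i, j))
          = alpha / real k + (\<Sum>j\<in>{..<k} - {i}. (1 - alpha) / (real k * (real k - 1)))"
        by (simp add: edge_weight_def)
    qed
    also have "\<dots> = (\<Sum>i<k. alpha / real k + (1 - alpha) / real k)"
      using k by (intro sum.cong refl) (simp add: of_nat_diff field_simps)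
    also have "\<dots> = 1" using k by (simp add: field_simps)
    finally show ?thesis .
  qed
  show "(\<Sum>i<k. terminal_weight e i) + (\<Sum>v\<in>points k. point_weight k e v) = 1"
    if eE: "e \<in> {..<k} \<times> {..<k}" for e
  proof -
    obtain i j where e: "e = (i, j)" "i < k" "j < k" using eE by auto
    have p: "(\<Sum>v\<in>points k. point_weight k e v) = (\<Sum>r<k. pw k i j r * 1)"
      unfolding e(1) using sum_point_weight[OF e(2,3), of "\<lambda>_. 1"] by simp
    show ?thesis
    proof (cases "i = j")
      case True
      have "(\<Sum>i'<k. terminal_weight e i') = (\<Sum>i'<k. if i' = i then 1/2 else 0)"
        by (rule sum.cong) (auto simp: terminal_weight_def e True)
      then have "(\<Sum>i'<k. terminal_weight e i') = 1/2" using e by simp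
      moreover have "(\<Sum>r<k. pw k i i r * 1) = 1/2"
        unfolding sum_pw_diag[OF e(2)] using e k by (simp add: of_nat_diff field_simps)
      ultimately show ?thesis unfolding p using True by simp
    next
      case False
      then have "(\<Sum>i'<k. terminal_weight e i') = 0"
        by (intro sum.neutral) (auto simp: terminal_weight_def e)
      moreover have "(\<Sum>r<k. pw k i j r * 1) = 1"
        unfolding sum_pw_off_diag[OF e(2,3) False]
        using e k False by (simp add: card_Diff_subset of_nat_diff cw_def bw_def)
      ultimately show ?thesis unfolding p by simp
    qed
  qed
  show "\<exists>c<k. (\<forall>i<k. 0 < terminal_weight e i \<longrightarrow> i = c) \<and>
      (\<forall>v\<in>points k. 0 < point_weight k e v \<longrightarrow> label v (roles e v \<omega>) = c)"
    if e: "e \<in> {..<k} \<times> {..<k}" and "\<omega> < 2" for e \<omega>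
  proof -
    have \<omega>: "\<omega> = 0 \<or> \<omega> = 1" using \<open>\<omega> < 2\<close> by auto
    define c where "c = (if \<omega> = 0 then fst e else snd e)"
    have "c < k" using e by (auto simp: c_def mem_Times_iff)
    moreover have "i = c" if "0 < terminal_weight e i" for i
      using that by (auto simp: terminal_weight_def c_def split: if_splits)
    moreover have "label v (roles e v \<omega>) = c" if "0 < point_weight k e v" for v
    proof -
      have "\<exists>r<k. v = {#fst e, snd e, r#}"
      proof (rule ccontr)
        assume "\<not> ?thesis"
        then have "point_weight k e v = 0" unfolding point_weight_def by (intro sum.neutral) auto
        then show False using that by simp
      qed
      then obtain r where "v = {#fst e, snd e, r#}" by blast
      from label_roles[OF this] show ?thesis using \<omega> by (auto simp: c_def)
    qed
    ultimately show ?thesis by blast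
  qed
qed

lemma sum_off_diag_swap:
  "(\<Sum>i<k. \<Sum>j\<in>{..<k} - {i}. h j i) = (\<Sum>i<k. \<Sum>j\<in>{..<k} - {i}. h i j)"
  for h :: "nat \<Rightarrow> nat \<Rightarrow> real" and k :: nat
proof -
  have "(\<Sum>i<k. \<Sum>j\<in>{..<k} - {i}. g i j) = (\<Sum>i<k. \<Sum>j<k. of_bool (i \<noteq> j) * g i j)" for g :: "nat \<Rightarrow> nat \<Rightarrow> real"
    by (intro sum.cong refl sum.mono_neutral_cong_left) auto
  moreover have "(\<Sum>i<k. \<Sum>j<k. of_bool (i \<noteq> j) * h j i) = (\<Sum>j<k. \<Sum>i<k. of_bool (i \<noteq> j) * h j i)"
    by (rule sum.swap)
  ultimately show ?thesis by (simp add: eq_commute)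
qed

lemma gap_bound:
  assumes k: "k \<ge> 1000000"
    and y: "\<And>v l. v \<in> points k \<Longrightarrow> y v l \<ge> 0" "\<And>v. v \<in> points k \<Longrightarrow> (\<Sum>l<k. y v l) = 1"
  shows "1268/3000 \<le> (\<Sum>e\<in>{..<k} \<times> {..<k}. edge_weight k e *
     (\<Sum>l<k. hat (terminal_weight e l + (\<Sum>v\<in>points k. point_weight k e v * y v l))))"
proof -
  interpret labelling k y
    by unfold_locales (use k y in_points in auto)
  let ?w = "\<lambda>i j l. terminal_weight (i, j) l + (\<Sum>v\<in>points k. point_weight k (i, j) v * y v l)"
  have off: "(\<Sum>l<k. hat (?w i j l)) = (\<Sum>l<k. hat (wt i j l))" if "i < k" "j < k" "i \<noteq> j" for i j
  proof -
    have "?w i j l = wt i j l" for l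
      using that by (simp add: sum_point_weight sum_pw_off_diag terminal_weight_def wt_def q_def)
    then show ?thesis by simp
  qed
  have k1: "real k - 1 > 0" using k by simp
  have diag: "(\<Sum>l<k. hat (?w i i l)) = (\<Sum>j\<in>{..<k} - {i}. 1 - y {#i, i, j#} i) / (real k - 1)" if i: "i < k" for i
  proof -
    have w: "?w i i l = (if l = i then 1/2 else 0) + (\<Sum>j\<in>{..<k} - {i}. y {#i, i, j#} l) / (2 * (real k - 1))" for l
      using i by (simp add: sum_point_weight sum_pw_diag terminal_weight_def)
    have nn: "(\<Sum>j\<in>{..<k} - {i}. y {#i, i, j#} l) / (2 * (real k - 1)) \<ge> 0" for l
      using i k1 by (intro divide_nonneg_nonneg sum_nonneg) (auto simp: y_nonneg)
    have w0: "?w i i l \<ge> 0" for l unfolding w using nn[of l] by simp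
    have card1: "real (card ({..<k} - {i})) = real k - 1" using i by (simp add: of_nat_diff)
    have "(\<Sum>l<k. \<Sum>j\<in>{..<k} - {i}. y {#i, i, j#} l) = (\<Sum>j\<in>{..<k} - {i}. \<Sum>l<k. y {#i, i, j#} l)"
      by (rule sum.swap)
    also have "\<dots> = (\<Sum>j\<in>{..<k} - {i}. 1)"
      by (intro sum.cong refl) (use i y_sum in auto)
    finally have "(\<Sum>l<k. \<Sum>j\<in>{..<k} - {i}. y {#i, i, j#} l) = real k - 1" using card1 by simp
    then have w1: "(\<Sum>l<k. ?w i i l) = 1"
      unfolding w sum.distrib sum_divide_distrib[symmetric] using i k1 by (simp add: field_simps)
    have "(\<Sum>l<k. hat (?w i i l)) = 2 * (1 - ?w i i i)"
    proof (cases "?w i i i > 1/2")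
      case True
      then show ?thesis using sum_hat(2)[of k "?w i i" i] w0 w1 i by blast
    next
      case False
      then have half: "?w i i i = 1/2" using w[of i] nn[of i] by simp
      have "?w i i l \<le> 1/2" if "l < k" for l
      proof (cases "l = i")
        case False
        have "(\<Sum>l\<in>{i, l}. ?w i i l) \<le> (\<Sum>l<k. ?w i i l)"
          using that i w0 by (intro sum_mono2) auto
        then show ?thesis unfolding w1 using False half by simp
      qed (simp add: half)
      then have "(\<Sum>l<k. hat (?w i i l)) = 1" using sum_hat(1)[of k "?w i i"] w0 w1 by blast
      then show ?thesis using half by simp
    qed
    also have "\<dots> = (real k - 1 - (\<Sum>j\<in>{..<k} - {i}. y {#i, i, j#} i)) / (real k - 1)"
      unfolding w using k1 by (simp add: field_simps)
    also have "\<dots> = (\<Sum>j\<in>{..<k} - {i}. 1 - y {#i, i, j#} i) / (real k - 1)"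
      by (simp add: sum_subtractf card1)
    finally show ?thesis .
  qed
  have "(\<Sum>e\<in>{..<k} \<times> {..<k}. edge_weight k e *
     (\<Sum>l<k. hat (terminal_weight e l + (\<Sum>v\<in>points k. point_weight k e v * y v l))))
    = (\<Sum>i<k. \<Sum>j<k. edge_weight k (i, j) * (\<Sum>l<k. hat (?w i j l)))"
    by (simp add: sum.cartesian_product split_def)
  also have "\<dots> = (\<Sum>i<k. (\<Sum>j\<in>{..<k} - {i}.
      (alpha * (1 - y {#i, i, j#} i) + (1 - alpha) * (\<Sum>l<k. hat (wt i j l))) / (real k * (real k - 1))))"
  proof (rule sum.cong[OF refl])
    fix i assume i: "i \<in> {..<k}"
    have "(\<Sum>j<k. edge_weight k (i, j) * (\<Sum>l<k. hat (?w i j l)))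
      = edge_weight k (i, i) * (\<Sum>l<k. hat (?w i i l))
        + (\<Sum>j\<in>{..<k} - {i}. edge_weight k (i, j) * (\<Sum>l<k. hat (?w i j l)))"
      using i by (intro sum.remove) auto
    also have "edge_weight k (i, i) * (\<Sum>l<k. hat (?w i i l))
        = (\<Sum>j\<in>{..<k} - {i}. alpha * (1 - y {#i, i, j#} i) / (real k * (real k - 1)))"
      using i by (simp add: diag edge_weight_def sum_distrib_left sum_divide_distrib)
    also have "(\<Sum>j\<in>{..<k} - {i}. edge_weight k (i, j) * (\<Sum>l<k. hat (?w i j l)))
        = (\<Sum>j\<in>{..<k} - {i}. (1 - alpha) * (\<Sum>l<k. hat (wt i j l)) / (real k * (real k - 1)))"
      using i by (intro sum.cong refl) (auto simp: off edge_weight_def)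
    finally show "(\<Sum>j<k. edge_weight k (i, j) * (\<Sum>l<k. hat (?w i j l))) = (\<Sum>j\<in>{..<k} - {i}.
      (alpha * (1 - y {#i, i, j#} i) + (1 - alpha) * (\<Sum>l<k. hat (wt i j l))) / (real k * (real k - 1)))"
      by (simp only: sum.distrib[symmetric] add_divide_distrib)
  qed
  also have "\<dots> = (\<Sum>i<k. \<Sum>j\<in>{..<k} - {i}. pc i j) / (real k * (real k - 1))"
  proof -
    define A where "A = (\<Sum>i<k. \<Sum>j\<in>{..<k} - {i}. 1 - y {#i, i, j#} i)"
    define B where "B = (\<Sum>i<k. \<Sum>j\<in>{..<k} - {i}. \<Sum>l<k. hat (wt i j l))"
    have "(\<Sum>i<k. \<Sum>j\<in>{..<k} - {i}. 1 - y {#j, j, i#} j) = A"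
      unfolding A_def by (rule sum_off_diag_swap)
    then have "(\<Sum>i<k. \<Sum>j\<in>{..<k} - {i}. pc i j) = alpha / 2 * (A + A) + (1 - alpha) * B"
      unfolding pc_def A_def B_def sum.distrib sum_distrib_left[symmetric] by simp
    moreover have "(\<Sum>i<k. \<Sum>j\<in>{..<k} - {i}. alpha * (1 - y {#i, i, j#} i) + (1 - alpha) * (\<Sum>l<k. hat (wt i j l)))
        = alpha * A + (1 - alpha) * B"
      unfolding A_def B_def sum.distrib sum_distrib_left[symmetric] ..
    ultimately show ?thesis
      unfolding sum_divide_distrib[symmetric] by simp
  qed
  finally show ?thesis using sum_pc_ge k1 k by (simp add: pos_le_divide_eq)
qed

theorem theorem4:
  shows "\<exists>k0::nat. \<forall>k\<ge>k0. \<forall>r::real. r < 1.268 \<longrightarrow>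
           (\<exists>c::real. c > 0 \<and> (\<exists>N::nat. \<forall>n\<ge>N. \<forall>Alg.
              achieves_ratio k n r Alg \<longrightarrow>
              (\<exists>t f. valid_instance k n t f \<and>
                 (\<exists>T\<in>set_pmf (Alg t). 2 powr (c * real n) \<le> real (num_queries f T)))))"
proof (rule exI[of _ 1000000], intro allI impI)
  fix k :: nat and r :: real assume k: "1000000 \<le> k" and r: "r < 1.268"
  interpret gap_instance k "points k" label "{..<k} \<times> {..<k}" "edge_weight k" terminal_weight "point_weight k" roles
    by (rule gap_instance_points[OF k])
  show "\<exists>c::real. c > 0 \<and> (\<exists>N::nat. \<forall>n\<ge>N. \<forall>Alg.
              achieves_ratio k n r Alg \<longrightarrow>
              (\<exists>t f. valid_instance k n t f \<and>
                 (\<exists>T\<in>set_pmf (Alg t). 2 powr (c * real n) \<le> real (num_queries f T))))"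
    by (rule exponentially_many_queries[where \<tau> = "1268/3000"]) (use r gap_bound[OF k] in auto)
qed

end
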